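(* Let $n\ge 1$ be an integer. Consider the problem of finding a monic polynomial $Q$ (with complex coefficients) of degree exactly $n+D-2$ such that $$\int_{\mathbb{R}} x^k Q(x)\, e^{-V(x)}\,dx=0\qquad\text{for all integers } 0\le k\le n-1,$$ and, for all $j\in\{1,\dots,D-1\}\setminus\{D/2\}$, $$\int_0^{\infty_{2j}} Y_{2j}(z) e^{-\frac12 V(z)} Q(z)\,dz-\beta_j\int_0^{\infty_0} Y_0(z)e^{-\frac12 V(z)}Q(z)\,dz-\kappa_j\int_0^{\infty_D}Y_D(z)e^{-\frac12 V(z)}Q(z)\,dz=0 .$$ Then this problem has the unique solution $Q\equiv \Psi_n$.
   Context: Standing assumptions: $D\ge 4$ is an even integer, $\lambda>0$, and $V$ is a real polynomial with $V(x)=\gamma x^D+\mathcal{O}(x^{D-1})$, $\gamma>0$. Sobolev orthogonal polynomials: $\langle P,Q\rangle_S=\int_{\mathbb{R}}P(x)Q(x)e^{-V(x)}dx+\lambda\int_{\mathbb{R}}P'(x)Q'(x)e^{-V(x)}dx$ on real polynomials. $P_n$ ($n\ge0$) is the unique monic polynomial of degree $n$ such that $\langle P_n,P_m\rangle_S=0$ for all $n\ne m$. The dual polynomial is $\Psi_n=\nu_n\big(V'P_n'-P_n''+\lambda^{-1}P_n\big)$, where $\nu_n=\frac{1}{nD\gamma}$ for $n\ge1$ and $\nu_0=\lambda$. Sibuya solutions: let $\varphi(z)=(\gamma^{-1}V(z))^{1/D}$ on a neighbourhood of infinity, with the branch such that $\varphi(z)=z(1+\mathcal{O}(z^{-1}))$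 as $z\to\infty$, and let $\varphi^{-1}$ be its inverse near infinity. Fix $\varrho>0$ sufficiently large that $\varphi$ and $\varphi^{-1}$ are both injective on $\{|z|>\frac12\varrho\}$, $\frac12|z|\le|\varphi(z)|\le 2|z|$ for $|z|\ge\varrho$, and $\frac{(D-1)\varrho^{-D}}{\gamma D}\le\frac12$. For $k\in\{0,\dots,2D-1\}$ put $\Omega_k=\varphi^{-1}\big(\{w\in\mathbb{C}:|w|\ge\varrho,\ \pi\frac{k-1}{D}\le\arg w\le\pi\frac{k+1}{D}\}\big)$ (arguments modulo $2\pi$). $F_k$ is the unique entire function with $(-1)^kV'F_k'-F_k''+\lambda^{-1}F_k=0$ on $\mathbb{C}$ and $F_k(z)=1+\mathcal{O}(|z|^{2-D})$ as $|z|\to\infty$, $z\in\Omega_k$. Define $Y_k(z)=i^k e^{-i\pi/4}e^{-\frac12V(z)}F_k(z)$ for $k$ even and $Y_k(z)=i^ke^{-i\pi/4}\lambda\,e^{\frac12V(z)}F_k'(z)$ for $k$ odd. Wronskians: $W[f,g]=fg'-f'g$. The Wronskians $W[Y_k,Y_j]$ are constants and $W[Y_0,Y_D]\ne0$. For $j\in\{1,\dots,D-1\}\setminus\{D/2\}$: $\beta_j=-\frac{W[Y_D,Y_{2j}]}{W[Y_0,Y_D]}$ and $\kappa_j=\frac{W[Y_0,Y_{2j}]}{W[Y_0,Y_D]}$. Integrals $\int_0^{\infty_k}$ are taken along the ray from $0$ to $\infty_k:=e^{i\pi k/D}\infty$ (so $\infty_0=+\infty$, $\infty_D=-\infty$).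 *)

theory Defs
  imports "HOL-Complex_Analysis.Complex_Analysis" "HOL-Library.Landau_Symbols"
begin

abbreviation cpoly :: "real poly \<Rightarrow> complex poly" where
  "cpoly p \<equiv> map_poly complex_of_real p"

subsection \<open>Sobolev orthogonal polynomials and their duals\<close>

definition sobolev_inner :: "real poly \<Rightarrow> real \<Rightarrow> real poly \<Rightarrow> real poly \<Rightarrow> real" where
  "sobolev_inner V lam P Q =
     (LBINT x. poly P x * poly Q x * exp (- poly V x))
     + lam * (LBINT x. poly (pderiv P) x * poly (pderiv Q) x * exp (- poly V x))"

definition is_sobolev_ops :: "real poly \<Rightarrow> real \<Rightarrow> (nat \<Rightarrow> real poly) \<Rightarrow> bool" where
  "is_sobolev_ops V lam P \<longleftrightarrow>
     (\<forall>n. degree (P n) = n \<and> lead_coeff (P n) = 1) \<and>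
     (\<forall>n m. n \<noteq> m \<longrightarrow> sobolev_inner V lam (P n) (P m) = 0)"

definition sobolev_poly :: "real poly \<Rightarrow> real \<Rightarrow> nat \<Rightarrow> real poly" where
  "sobolev_poly V lam = (THE P. is_sobolev_ops V lam P)"

definition dual_norm :: "nat \<Rightarrow> real \<Rightarrow> real \<Rightarrow> nat \<Rightarrow> real" where
  "dual_norm D \<gamma> lam n = (if n = 0 then lam else 1 / (real n * real D * \<gamma>))"

definition dual_poly :: "nat \<Rightarrow> real \<Rightarrow> real poly \<Rightarrow> real \<Rightarrow> nat \<Rightarrow> real poly" where
  "dual_poly D \<gamma> V lam n =
     (let P = sobolev_poly V lam n in
      smult (dual_norm D \<gamma> lam n)
        (pderiv V * pderiv P - pderiv (pderiv P) + smult (1 / lam) P))"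

subsection \<open>Sibuya solutions\<close>

text \<open>
  \<open>\<phi>\<close> is the branch of \<open>(V/\<gamma>)\<^sup>1\<^sup>/\<^sup>D\<close> with \<open>\<phi>(z) = z (1 + O(1/z))\<close>, and \<open>\<psi>\<close> is its inverse,
  which is only required to invert \<open>\<phi>\<close> near infinity. Both are determined on \<open>|z| > \<rho>/2\<close> by
  analytic continuation (that set is connected); their values elsewhere are irrelevant.
  That \<open>\<rho>\<close> is sufficiently large includes that both functions are defined and holomorphic
  on \<open>|z| > \<rho>/2\<close>.
\<close>

definition sibuya_chart ::
  "nat \<Rightarrow> real \<Rightarrow> real poly \<Rightarrow> real \<Rightarrow> (complex \<Rightarrow> complex) \<Rightarrow> (complex \<Rightarrow> complex) \<Rightarrow> bool" where
  "sibuya_chart D \<gamma> V \<rho> \<phi> \<psi> \<longleftrightarrow>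
     \<rho> > 0 \<and>
     \<phi> holomorphic_on {z. norm z > \<rho> / 2} \<and>
     (\<forall>z. norm z > \<rho> / 2 \<longrightarrow> \<phi> z ^ D = poly (cpoly V) z / of_real \<gamma>) \<and>
     (\<lambda>z. \<phi> z / z - 1) \<in> O[at_infinity](\<lambda>z. 1 / z) \<and>
     \<psi> holomorphic_on {w. norm w > \<rho> / 2} \<and>
     (\<forall>\<^sub>F z in at_infinity. \<psi> (\<phi> z) = z) \<and>
     (\<forall>\<^sub>F w in at_infinity. \<phi> (\<psi> w) = w) \<and>
     inj_on \<phi> {z. norm z > \<rho> / 2} \<and>
     inj_on \<psi> {w. norm w > \<rho> / 2} \<and>
     (\<forall>z. norm z \<ge> \<rho> \<longrightarrow> norm z / 2 \<le> norm (\<phi> z) \<and> norm (\<phi> z) \<le> 2 * norm z) \<and>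
     (real D - 1) / (\<rho> ^ D * \<gamma> * real D) \<le> 1 / 2"

definition sibuya_sector :: "nat \<Rightarrow> real \<Rightarrow> (complex \<Rightarrow> complex) \<Rightarrow> nat \<Rightarrow> complex set" where
  "sibuya_sector D \<rho> \<psi> k =
     \<psi> ` {w. \<exists>r \<theta>. w = rcis r \<theta> \<and> r \<ge> \<rho> \<and>
                pi * (real k - 1) / real D \<le> \<theta> \<and> \<theta> \<le> pi * (real k + 1) / real D}"

definition is_sibuya_F ::
  "nat \<Rightarrow> real poly \<Rightarrow> real \<Rightarrow> real \<Rightarrow> (complex \<Rightarrow> complex) \<Rightarrow> nat \<Rightarrow> (complex \<Rightarrow> complex) \<Rightarrow> bool" where
  "is_sibuya_F D V lam \<rho> \<psi> k F \<longleftrightarrow>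
     F holomorphic_on UNIV \<and>
     (\<forall>z. (-1) ^ k * poly (cpoly (pderiv V)) z * deriv F z - deriv (deriv F) z
            + F z / of_real lam = 0) \<and>
     (\<lambda>z. F z - 1) \<in> O[inf at_infinity (principal (sibuya_sector D \<rho> \<psi> k))](\<lambda>z. of_real (norm z) powi (2 - int D))"

definition sibuya_Y ::
  "real poly \<Rightarrow> real \<Rightarrow> (nat \<Rightarrow> complex \<Rightarrow> complex) \<Rightarrow> nat \<Rightarrow> complex \<Rightarrow> complex" where
  "sibuya_Y V lam F k z =
     (if even k
      then \<i> ^ k * exp (- \<i> * of_real pi / 4) * exp (- poly (cpoly V) z / 2) * F k z
      else \<i> ^ k * exp (- \<i> * of_real pi / 4) * of_real lam * exp (poly (cpoly V) z / 2)
             * deriv (F k) z)"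

definition wronskian :: "(complex \<Rightarrow> complex) \<Rightarrow> (complex \<Rightarrow> complex) \<Rightarrow> complex \<Rightarrow> complex" where
  "wronskian f g z = f z * deriv g z - deriv f z * g z"

text \<open>
  The Wronskians of the \<open>Y\<^sub>k\<close> are constant functions, as all \<open>Y\<^sub>k\<close> solve one equation
  \<open>Y'' = q Y\<close>; the constants are read off at \<open>0\<close>.
\<close>

definition conn_beta ::
  "nat \<Rightarrow> real poly \<Rightarrow> real \<Rightarrow> (nat \<Rightarrow> complex \<Rightarrow> complex) \<Rightarrow> nat \<Rightarrow> complex" where
  "conn_beta D V lam F j =
     - wronskian (sibuya_Y V lam F D) (sibuya_Y V lam F (2 * j)) 0
       / wronskian (sibuya_Y V lam F 0) (sibuya_Y V lam F D) 0"

definition conn_kappa ::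
  "nat \<Rightarrow> real poly \<Rightarrow> real \<Rightarrow> (nat \<Rightarrow> complex \<Rightarrow> complex) \<Rightarrow> nat \<Rightarrow> complex" where
  "conn_kappa D V lam F j =
     wronskian (sibuya_Y V lam F 0) (sibuya_Y V lam F (2 * j)) 0
       / wronskian (sibuya_Y V lam F 0) (sibuya_Y V lam F D) 0"

subsection \<open>The orthogonality problem\<close>

text \<open>The integral of \<open>f\<close> along the ray from \<open>0\<close> in direction \<open>exp(i \<pi> k / D)\<close>.\<close>

definition ray_integral :: "nat \<Rightarrow> nat \<Rightarrow> (complex \<Rightarrow> complex) \<Rightarrow> complex" where
  "ray_integral D k f =
     (LBINT r:{0..}. f (of_real r * cis (pi * real k / real D)) * cis (pi * real k / real D))"

definition Y_moment ::
  "nat \<Rightarrow> real poly \<Rightarrow> real \<Rightarrow> (nat \<Rightarrow> complex \<Rightarrow> complex) \<Rightarrow> nat \<Rightarrow> complex poly \<Rightarrow> complex" where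
  "Y_moment D V lam F k Q =
     ray_integral D k
       (\<lambda>z. sibuya_Y V lam F k z * exp (- poly (cpoly V) z / 2) * poly Q z)"

definition solves_problem ::
  "nat \<Rightarrow> real poly \<Rightarrow> real \<Rightarrow> (nat \<Rightarrow> complex \<Rightarrow> complex) \<Rightarrow> nat \<Rightarrow> complex poly \<Rightarrow> bool" where
  "solves_problem D V lam F n Q \<longleftrightarrow>
     degree Q = n + D - 2 \<and> lead_coeff Q = 1 \<and>
     (\<forall>k<n. (LBINT x. of_real x ^ k * poly Q (of_real x) * of_real (exp (- poly V x))) = 0) \<and>
     (\<forall>j \<in> {1..D - 1} - {D div 2}.
        Y_moment D V lam F (2 * j) Q
        - conn_beta D V lam F j * Y_moment D V lam F 0 Q
        - conn_kappa D V lam F j * Y_moment D V lam F D Q = 0)"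

end

theory Submission
  imports Defs
begin

text \<open>
  Let \<open>L f = V' f' - f'' + f / \<lambda>\<close>. Integration by parts turns the Sobolev product into
  \<open>\<langle>P, R\<rangle>\<^sub>S = \<lambda> \<integral> R (L P) e\<^sup>-\<^sup>V\<close>, and \<open>\<Psi>\<^sub>n = \<nu>\<^sub>n L P\<^sub>n\<close>. So for a polynomial of the form \<open>Q = L P\<close> the
  conditions on the real line say that \<open>P\<close> is Sobolev orthogonal to all polynomials of degree
  below \<open>n\<close>. Since \<open>L\<close> raises the degree of a nonconstant polynomial by exactly \<open>D - 2\<close>, the degree
  and the leading coefficient of \<open>Q\<close> then leave only \<open>P = \<nu>\<^sub>n P\<^sub>n\<close>
  (\<open>eq_0_if_sobolev_op_orthogonal\<close>). It remains to see that the \<open>D - 2\<close> ray conditions hold exactly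
  for the polynomials in the image of \<open>L\<close> (\<open>ray_conditions_iff_sobolev_op\<close>).

  The link is Lagrange's identity: if \<open>L f = Q\<close> and \<open>L F = 0\<close>, then the concomitant
  \<open>e\<^sup>-\<^sup>V (f F' - f' F)\<close> has the derivative \<open>e\<^sup>-\<^sup>V F Q\<close>. Hence the integral of \<open>e\<^sup>-\<^sup>V F\<^sub>k Q\<close> along the \<open>k\<close>-th
  ray, \<open>k\<close> even, is the difference of the values of the concomitant at infinity and at \<open>0\<close>
  (\<open>concomitant_ray_limit\<close>).

  If \<open>f\<close> is a polynomial, the concomitant vanishes at infinity, so the ray integrals depend on \<open>f\<close>
  only through \<open>(f 0, f' 0)\<close> and are, up to a common factor, the Wronskians of this pair with the
  pairs \<open>(F\<^sub>k 0, F\<^sub>k' 0)\<close>. Three vectors in the plane are linearly dependent, and up to the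
  normalisation of the \<open>Y\<^sub>k\<close> the numbers \<open>\<beta>\<^sub>j\<close> and \<open>\<kappa>\<^sub>j\<close> are the coefficients of the relation between the
  pairs with indices \<open>2j\<close>, \<open>0\<close> and \<open>D\<close>. That the last two are independent
  follows from an energy argument on the two real half-lines (\<open>jet_wr_0_D_nonzero\<close>).

  Conversely, variation of constants yields an entire solution of \<open>L f = Q\<close> whose concomitants with
  \<open>F\<^sub>0\<close> and \<open>F\<^sub>D\<close> vanish at infinity, and the ray conditions propagate this to all \<open>F\<^sub>2\<^sub>j\<close>
  (\<open>entire_solution_exists\<close>). A vanishing concomitant keeps \<open>f\<close> polynomially bounded on the ray
  (\<open>ray_bound_of_vanishing_concomitant\<close>). On rays where \<open>Re V\<close> tends to \<open>-\<infinity>\<close> every solution is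
  polynomially bounded (\<open>ray_bound_of_falling_weight\<close>), and in the whole plane \<open>f\<close> grows at most like
  \<open>exp (C |z|\<^sup>D)\<close> (\<open>solution_growth\<close>). The \<open>3D\<close> rays with arguments \<open>2\<pi>m / (3D)\<close> are of one of the two
  kinds, and they cut the plane into sectors of opening less than \<open>\<pi> / D\<close>, where the
  Phragmen-Lindeloef principle applies. So \<open>f\<close> is entire with polynomial growth, that is, a
  polynomial (\<open>solution_is_poly\<close>).
\<close>

section \<open>Growth lemmas on half-lines and in sectors\<close>

lemma gronwall_exp:
  fixes Z k :: "real \<Rightarrow> real"
  assumes Z: "\<And>r. r \<ge> a \<Longrightarrow> (Z has_real_derivative Z' r) (at r)"
    and k: "\<And>r. r \<ge> a \<Longrightarrow> (k has_real_derivative k' r) (at r)"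
    and le: "\<And>r. r \<ge> a \<Longrightarrow> Z' r \<le> k' r * Z r"
    and "r \<ge> a"
  shows "Z r \<le> Z a * exp (k r - k a)"
proof -
  have "Z r * exp (- k r) \<le> Z a * exp (- k a)"
  proof (rule DERIV_nonpos_imp_nonincreasing[OF \<open>r \<ge> a\<close>])
    fix x assume x: "a \<le> x" "x \<le> r"
    have "((\<lambda>r. Z r * exp (- k r)) has_real_derivative (Z' x - k' x * Z x) * exp (- k x)) (at x)"
      using x by (auto intro!: derivative_eq_intros Z k simp: algebra_simps)
    moreover have "(Z' x - k' x * Z x) * exp (- k x) \<le> 0"
      using le[of x] x by (auto simp: mult_le_0_iff)
    ultimately show "\<exists>y. ((\<lambda>r. Z r * exp (- k r)) has_real_derivative y) (at x) \<and> y \<le> 0" by blast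
  qed
  hence "Z r * exp (- k r) * exp (k r) \<le> Z a * exp (- k a) * exp (k r)"
    by (intro mult_right_mono) auto
  thus ?thesis by (simp add: mult.assoc flip: exp_add)
qed

text \<open>
  Over an interval of length one the increment of \<open>h\<close> tends to \<open>0\<close>, because \<open>h\<close> converges, and
  to \<open>m\<close>, because the derivative does.
\<close>

lemma limit_of_derivative_eq_0:
  fixes h :: "real \<Rightarrow> 'a::real_normed_vector"
  assumes h: "\<And>r. r \<ge> a \<Longrightarrow> (h has_vector_derivative h' r) (at r)"
    and lim: "(h \<longlongrightarrow> c) at_top" and lim': "(h' \<longlongrightarrow> m) at_top"
  shows "m = 0"
proof (rule ccontr)
  assume "m \<noteq> 0"
  define e where "e = norm m / 3"
  have e: "e > 0" using \<open>m \<noteq> 0\<close> by (simp add: e_def)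
  have "\<forall>\<^sub>F r in at_top. dist (h' r) m < e \<and> dist (h r) c < e / 2"
    using tendstoD[OF lim' e] tendstoD[OF lim, of "e/2"] e by (auto intro: eventually_conj)
  then obtain R where R: "\<And>r. r \<ge> R \<Longrightarrow> dist (h' r) m < e" "\<And>r. r \<ge> R \<Longrightarrow> dist (h r) c < e / 2"
    unfolding eventually_at_top_linorder by blast
  define r where "r = max R a"
  have "norm ((h (r+1) - (r+1) *\<^sub>R m) - (h r - r *\<^sub>R m)) \<le> e * (r + 1) - e * r"
  proof (rule differentiable_bound_general[where f' = "\<lambda>x. h' x - m" and \<phi>' = "\<lambda>_. e"])
    fix x assume "r < x" "x < r + 1"
    hence "x \<ge> a" "x \<ge> R" by (auto simp: r_def)
    show "((\<lambda>x. h x - x *\<^sub>R m) has_vector_derivative h' x - m) (at x)"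
      using h[OF \<open>x \<ge> a\<close>] by (auto intro!: derivative_eq_intros)
    show "norm (h' x - m) \<le> e" using R(1)[OF \<open>x \<ge> R\<close>] by (simp add: dist_norm)
    show "((\<lambda>x. e * x) has_vector_derivative e) (at x)"
      by (auto intro!: derivative_eq_intros)
  next
    have "continuous_on {r..r+1} h"
      by (intro continuous_at_imp_continuous_on ballI has_vector_derivative_continuous[OF h]) (auto simp: r_def)
    thus "continuous_on {r..r+1} (\<lambda>x. h x - x *\<^sub>R m)" by (intro continuous_intros)
  qed (auto intro!: continuous_intros)
  hence "norm (h (r+1) - h r - m) \<le> e" by (simp add: algebra_simps)
  moreover have "norm (h (r+1) - h r) < e"
    using R(2)[of r] R(2)[of "r+1"] dist_triangle_less_add[of "h (r+1)" c "e/2" "h r" "e/2"]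
    by (auto simp: r_def dist_norm norm_minus_commute)
  ultimately have "norm m < e + e"
    using norm_triangle_sub[of m "h (r+1) - h r"] norm_minus_commute[of m "h (r+1) - h r"] by linarith
  thus False using e by (simp add: e_def)
qed

text \<open>
  The hypotheses replace the estimate \<open>|G r| \<le> \<integral>\<^sub>r\<^sup>\<infinity> |G'|\<close> by a comparison with an explicit
  antiderivative, so that tails of integrals never have to be computed.
\<close>

lemma norm_le_of_vanishing_majorant:
  fixes G :: "real \<Rightarrow> 'a::real_normed_vector"
  assumes G: "\<And>r. r \<ge> a \<Longrightarrow> (G has_vector_derivative G' r) (at r)"
    and h: "\<And>r. r \<ge> a \<Longrightarrow> (h has_real_derivative - h' r) (at r)"
    and le: "\<And>r. r \<ge> a \<Longrightarrow> norm (G' r) \<le> h' r"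
    and lim: "(G \<longlongrightarrow> 0) at_top" "(h \<longlongrightarrow> 0) at_top"
    and r: "r \<ge> a"
  shows "norm (G r) \<le> h r"
proof -
  have *: "norm (G R - G r) \<le> (- h R) - (- h r)" if R: "R > r" for R
  proof (rule differentiable_bound_general[OF R, where f' = G' and \<phi>' = h'])
    fix x assume "r < x" "x < R"
    thus "(G has_vector_derivative G' x) (at x)" "norm (G' x) \<le> h' x"
      "((\<lambda>x. - h x) has_vector_derivative h' x) (at x)"
      using r h[of x, THEN DERIV_minus] by (auto intro!: G le simp: has_real_derivative_iff_has_vector_derivative)
  next
    show "continuous_on {r..R} G"
      using r by (intro continuous_at_imp_continuous_on ballI has_vector_derivative_continuous[OF G]) auto
    show "continuous_on {r..R} (\<lambda>x. - h x)"
      using r by (intro continuous_at_imp_continuous_on ballI continuous_minus DERIV_isCont[OF h]) auto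
  qed
  have "((\<lambda>R. norm (G R - G r)) \<longlongrightarrow> norm (0 - G r)) at_top"
       "((\<lambda>R. (- h R) - (- h r)) \<longlongrightarrow> (- 0) - (- h r)) at_top"
    by (intro tendsto_intros lim)+
  moreover have "\<forall>\<^sub>F R in at_top. norm (G R - G r) \<le> (- h R) - (- h r)"
    by (rule eventually_mono[OF eventually_gt_at_top[of r]]) (rule *)
  ultimately have "norm (0 - G r) \<le> (- 0) - (- h r)"
    by (intro tendsto_le[OF trivial_limit_at_top_linorder])
  thus ?thesis by simp
qed

text \<open>
  A Phragmen-Lindeloef principle with polynomial instead of constant bounds on the two sides. In the
  logarithmic coordinate \<open>\<zeta> = ln z - i (\<alpha> + \<beta>) / 2\<close> the sector becomes a half-strip, the factor
  \<open>z\<^sup>N\<close> becomes the zero-free entire function \<open>exp (N \<zeta>)\<close>, by which one can divide, and the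
  damping factor \<open>exp (- \<epsilon> z\<^sup>b)\<close> becomes entire for every real \<open>b\<close>. As \<open>b\<close> exceeds the order of
  growth \<open>d\<close> and \<open>b (\<beta> - \<alpha>) < \<pi>\<close>, this factor beats \<open>f\<close> at the far end of the half-strip; the
  maximum principle on long rectangles and \<open>\<epsilon> \<rightarrow> 0\<close> then give the bound.
\<close>

lemma phragmen_lindelof_sector:
  fixes f :: "complex \<Rightarrow> complex" and \<alpha> \<beta> b d :: real
  assumes f: "f holomorphic_on UNIV" and b: "0 \<le> d" "d < b" and \<alpha>\<beta>: "\<alpha> \<le> \<beta>" "b * (\<beta> - \<alpha>) < pi"
    and growth: "\<And>z. norm (f z) \<le> C * exp (C * norm z powr d)"
    and ray: "\<And>r. r \<ge> 1 \<Longrightarrow> norm (f (rcis r \<alpha>)) \<le> M * r ^ N" "\<And>r. r \<ge> 1 \<Longrightarrow> norm (f (rcis r \<beta>)) \<le> M * r ^ N"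
  shows "\<exists>M'. \<forall>\<theta> r. \<alpha> \<le> \<theta> \<longrightarrow> \<theta> \<le> \<beta> \<longrightarrow> r \<ge> 1 \<longrightarrow> norm (f (rcis r \<theta>)) \<le> M' * r ^ N"
proof -
  define a where "a = (\<beta> - \<alpha>) / 2"
  define \<theta>0 where "\<theta>0 = (\<alpha> + \<beta>) / 2"
  have b0: "b > 0" using b by simp
  have a: "a \<ge> 0" "b * a < pi / 2" using \<alpha>\<beta> by (auto simp: a_def)
  have a_pi: "b * a \<le> pi" using a pi_gt_zero by linarith
  define c where "c = cos (b * a)"
  have c: "c > 0" unfolding c_def
  proof (rule cos_gt_zero_pi)
    have "0 \<le> b * a" using a b0 by simp
    thus "- (pi / 2) < b * a" using pi_gt_zero by linarith
  qed (rule a)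
  have C: "C \<ge> 0"
  proof (rule ccontr)
    assume "\<not> C \<ge> 0"
    hence "C * exp (C * norm (0::complex) powr d) < 0" by (simp add: mult_neg_pos)
    thus False using growth[of 0] norm_ge_zero[of "f 0"] by linarith
  qed
  define g where "g = (\<lambda>\<zeta>. f (exp (\<zeta> + \<i> * \<theta>0)) * exp (- of_nat N * \<zeta>))"
  define B where "B = max (max M (C * exp C)) 1"
  have cos_ge: "cos (b * y) \<ge> c" if "\<bar>y\<bar> \<le> a" for y
  proof -
    have "cos (b * y) = cos (b * \<bar>y\<bar>)" by (cases "y \<ge> 0") auto
    also have "\<dots> \<ge> c" unfolding c_def using that a a_pi b0
      by (intro cos_monotone_0_pi_le) (auto intro!: mult_left_mono)
    finally show ?thesis .
  qed
  have g_eq: "norm (g \<zeta>) = norm (f (rcis (exp (Re \<zeta>)) (Im \<zeta> + \<theta>0))) / exp (Re \<zeta>) ^ N" for \<zeta>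
  proof -
    have "exp (\<zeta> + \<i> * \<theta>0) = rcis (exp (Re \<zeta>)) (Im \<zeta> + \<theta>0)"
      by (simp add: exp_eq_polar rcis_def)
    thus ?thesis by (simp add: g_def norm_mult exp_minus norm_inverse norm_exp_eq_Re divide_inverse flip: exp_of_nat_mult)
  qed
  have "f \<circ> (\<lambda>\<zeta>. exp (\<zeta> + \<i> * \<theta>0)) holomorphic_on UNIV"
    by (rule holomorphic_on_compose) (auto intro!: holomorphic_intros holomorphic_on_subset[OF f])
  hence g_hol: "g holomorphic_on UNIV" unfolding g_def o_def
    by (intro holomorphic_intros)
  have key: "norm (g \<zeta>) \<le> B * exp (\<epsilon> * exp (b * Re \<zeta>))"
    if \<zeta>: "Re \<zeta> \<ge> 0" "\<bar>Im \<zeta>\<bar> \<le> a" and \<epsilon>: "\<epsilon> > 0" for \<zeta> \<epsilon>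
  proof -
    \<comment> \<open>the damping factor has modulus at most one on the half-strip, as \<open>cos (b Im \<zeta>) \<ge> c > 0\<close> there\<close>
    define h where "h = (\<lambda>\<zeta>. g \<zeta> * exp (- (of_real \<epsilon> * exp (of_real b * \<zeta>))))"
    have h_hol: "h holomorphic_on UNIV" unfolding h_def by (intro holomorphic_intros g_hol)
    have h_eq: "norm (h \<zeta>) = norm (g \<zeta>) * exp (- (\<epsilon> * exp (b * Re \<zeta>) * cos (b * Im \<zeta>)))" for \<zeta>
      by (simp add: h_def norm_mult Re_exp)
    have "eventually (\<lambda>x. C * exp (C * exp (d * x)) * exp (- (\<epsilon> * exp (b * x) * c)) \<le> 1) at_top"
    proof -
      have "((\<lambda>x. C * exp (C * exp (d * x)) * exp (- (\<epsilon> * exp (b * x) * c))) \<longlongrightarrow> 0) at_top"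
      proof -
        have 1: "filterlim (\<lambda>x. exp (b * x)) at_top at_top"
          by (intro filterlim_compose[OF exp_at_top] filterlim_tendsto_pos_mult_at_top[OF tendsto_const b0] filterlim_ident)
        have "((\<lambda>x. C * exp ((d - b) * x) - \<epsilon> * c) \<longlongrightarrow> C * 0 - \<epsilon> * c) at_top"
        proof (intro tendsto_intros)
          have "filterlim (\<lambda>x. (b - d) * x) at_top at_top"
            using b by (intro filterlim_tendsto_pos_mult_at_top[OF tendsto_const] filterlim_ident) auto
          hence "filterlim (\<lambda>x. - ((b - d) * x)) at_bot at_top" by (simp add: filterlim_uminus_at_bot)
          from filterlim_compose[OF exp_at_bot this]
          show "((\<lambda>x. exp ((d - b) * x)) \<longlongrightarrow> 0) at_top" by (simp add: algebra_simps)
        qed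
        from filterlim_tendsto_neg_mult_at_bot[OF this _ 1]
        have "filterlim (\<lambda>x. (C * exp ((d - b) * x) - \<epsilon> * c) * exp (b * x)) at_bot at_top" using \<epsilon> c by simp
        also have "(\<lambda>x. (C * exp ((d - b) * x) - \<epsilon> * c) * exp (b * x)) = (\<lambda>x. C * exp (d * x) - \<epsilon> * exp (b * x) * c)"
        proof
          fix x
          have "exp (d * x) = exp ((d - b) * x) * exp (b * x)" by (simp add: left_diff_distrib flip: exp_add)
          thus "(C * exp ((d - b) * x) - \<epsilon> * c) * exp (b * x) = C * exp (d * x) - \<epsilon> * exp (b * x) * c"
            by (simp add: left_diff_distrib)
        qed
        finally have "((\<lambda>x. exp (C * exp (d * x) - \<epsilon> * exp (b * x) * c)) \<longlongrightarrow> 0) at_top"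
          by (rule filterlim_compose[OF exp_at_bot])
        from tendsto_mult_left[OF this, of C] show ?thesis
          by (simp add: exp_diff exp_minus divide_inverse mult.assoc)
      qed
      hence "eventually (\<lambda>x. C * exp (C * exp (d * x)) * exp (- (\<epsilon> * exp (b * x) * c)) < 1) at_top"
        by (rule order_tendstoD) simp
      thus ?thesis by eventually_elim simp
    qed
    then obtain X0 where X0: "\<And>x. x \<ge> X0 \<Longrightarrow> C * exp (C * exp (d * x)) * exp (- (\<epsilon> * exp (b * x) * c)) \<le> 1"
      by (auto simp: eventually_at_top_linorder)
    \<comment> \<open>far enough to the right for the damping to win, and to the right of the given point\<close>
    define X where "X = max X0 (Re \<zeta>)"
    have X: "X \<ge> 0" "X \<ge> Re \<zeta>" using \<zeta> by (auto simp: X_def)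
    have g_growth: "norm (g \<xi>) \<le> C * exp (C * exp (d * Re \<xi>))" if "Re \<xi> \<ge> 0" for \<xi>
    proof -
      have "norm (g \<xi>) \<le> norm (f (rcis (exp (Re \<xi>)) (Im \<xi> + \<theta>0))) / 1"
        unfolding g_eq using that by (intro divide_left_mono) auto
      also have "\<dots> \<le> C * exp (C * exp (d * Re \<xi>))"
        using growth[of "rcis (exp (Re \<xi>)) (Im \<xi> + \<theta>0)"]
        by (simp add: powr_def)
      finally show ?thesis .
    qed
    let ?S = "cbox (Complex 0 (-a)) (Complex X a)"
    have "norm (h \<zeta>) \<le> B"
    proof (rule maximum_modulus_frontier[of h ?S])
      fix \<xi> assume "\<xi> \<in> frontier ?S"
      hence \<xi>: "\<xi> \<in> ?S" "\<xi> \<notin> box (Complex 0 (-a)) (Complex X a)"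
        by (auto simp: frontier_cbox)
      have in1: "0 \<le> Re \<xi>" "Re \<xi> \<le> X" "- a \<le> Im \<xi>" "Im \<xi> \<le> a"
        using \<xi>(1) by (auto simp: in_cbox_complex_iff)
      have cg: "cos (b * Im \<xi>) \<ge> c" by (rule cos_ge) (use in1 in linarith)
      have le1: "exp (- (\<epsilon> * exp (b * Re \<xi>) * cos (b * Im \<xi>))) \<le> 1"
        using cg c \<epsilon> by (simp add: mult_nonneg_nonneg)
      have hg: "norm (h \<xi>) \<le> norm (g \<xi>)"
        unfolding h_eq using mult_left_mono[OF le1, of "norm (g \<xi>)"] by simp
      have "Re \<xi> = 0 \<or> Re \<xi> = X \<or> Im \<xi> = a \<or> Im \<xi> = -a"
        using \<xi>(2) in1 unfolding in_box_complex_iff complex.sel greaterThanLessThan_iff by linarith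
      then consider "Re \<xi> = 0" | "Re \<xi> = X" | "Im \<xi> = a" | "Im \<xi> = -a" by blast
      thus "norm (h \<xi>) \<le> B"
      proof cases
        case 1
        hence "norm (g \<xi>) \<le> C * exp C" using g_growth[of \<xi>] by simp
        thus ?thesis using hg unfolding B_def by linarith
      next
        case 2
        have "norm (h \<xi>) \<le> C * exp (C * exp (d * Re \<xi>)) * exp (- (\<epsilon> * exp (b * Re \<xi>) * c))"
          unfolding h_eq using \<epsilon> C cg in1
          by (intro mult_mono g_growth iffD2[OF exp_le_cancel_iff] iffD2[OF neg_le_iff_le] mult_left_mono) auto
        also have "\<dots> \<le> 1" using X0[of X] 2 by (simp add: X_def)
        finally show ?thesis unfolding B_def by linarith
      next
        case 3
        have "Im \<xi> + \<theta>0 = \<beta>" using 3 by (simp add: a_def \<theta>0_def field_simps)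
        hence "norm (g \<xi>) \<le> M" using ray(2)[of "exp (Re \<xi>)"] in1 unfolding g_eq by (simp add: divide_le_eq)
        thus ?thesis using hg unfolding B_def by linarith
      next
        case 4
        have "Im \<xi> + \<theta>0 = \<alpha>" using 4 by (simp add: a_def \<theta>0_def field_simps)
        hence "norm (g \<xi>) \<le> M" using ray(1)[of "exp (Re \<xi>)"] in1 unfolding g_eq by (simp add: divide_le_eq)
        thus ?thesis using hg unfolding B_def by linarith
      qed
    next
      show "\<zeta> \<in> ?S" using \<zeta> X by (auto simp: in_cbox_complex_iff)
    qed (auto intro!: holomorphic_on_subset[OF h_hol] holomorphic_on_imp_continuous_on bounded_cbox)
    hence "norm (g \<zeta>) \<le> B * exp (\<epsilon> * exp (b * Re \<zeta>) * cos (b * Im \<zeta>))"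
      unfolding h_eq by (simp add: exp_minus field_simps)
    also have "\<dots> \<le> B * exp (\<epsilon> * exp (b * Re \<zeta>) * 1)"
      using \<epsilon> by (intro mult_left_mono iffD2[OF exp_le_cancel_iff]) (auto simp: B_def)
    finally show ?thesis by simp
  qed
  have "norm (f (rcis r \<theta>)) \<le> B * r ^ N" if "\<alpha> \<le> \<theta>" "\<theta> \<le> \<beta>" "r \<ge> 1" for \<theta> r
  proof -
    define \<zeta> where "\<zeta> = Complex (ln r) (\<theta> - \<theta>0)"
    have \<zeta>: "Re \<zeta> \<ge> 0" "\<bar>Im \<zeta>\<bar> \<le> a" using that by (auto simp: \<zeta>_def a_def \<theta>0_def field_simps)
    have "norm (g \<zeta>) \<le> B"
    proof (rule tendsto_lowerbound)
      have "((\<lambda>\<epsilon>. B * exp (\<epsilon> * exp (b * Re \<zeta>))) \<longlongrightarrow> B * exp (0 * exp (b * Re \<zeta>))) (at_right 0)"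
        by (intro tendsto_intros)
      thus "((\<lambda>\<epsilon>. B * exp (\<epsilon> * exp (b * Re \<zeta>))) \<longlongrightarrow> B) (at_right 0)" by simp
      show "\<forall>\<^sub>F \<epsilon> in at_right 0. norm (g \<zeta>) \<le> B * exp (\<epsilon> * exp (b * Re \<zeta>))"
        using eventually_at_right_less[of 0] by eventually_elim (rule key[OF \<zeta>])
    qed auto
    thus ?thesis using that unfolding g_eq by (simp add: \<zeta>_def divide_le_eq)
  qed
  thus ?thesis by blast
qed

section \<open>Exponential weights on rays and on the real line\<close>

lemma norm_poly_le_power:
  fixes p :: "complex poly"
  shows "\<exists>C\<ge>0. \<forall>z. norm (poly p z) \<le> C * (1 + norm z) ^ degree p"
proof (intro exI[of _ "\<Sum>i\<le>degree p. norm (coeff p i)"] conjI allI)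
  fix z
  have "norm (poly p z) \<le> (\<Sum>i\<le>degree p. norm (coeff p i * z ^ i))"
    unfolding poly_altdef by (rule norm_sum)
  also have "\<dots> \<le> (\<Sum>i\<le>degree p. norm (coeff p i) * (1 + norm z) ^ degree p)"
  proof (rule sum_mono)
    fix i assume "i \<in> {..degree p}"
    have "norm z ^ i \<le> (1 + norm z) ^ i" by (rule power_mono) auto
    also have "\<dots> \<le> (1 + norm z) ^ degree p" using \<open>i \<in> _\<close> by (intro power_increasing) auto
    finally show "norm (coeff p i * z ^ i) \<le> norm (coeff p i) * (1 + norm z) ^ degree p"
      by (simp add: norm_mult norm_power mult_left_mono)
  qed
  finally show "norm (poly p z) \<le> (\<Sum>i\<le>degree p. norm (coeff p i)) * (1 + norm z) ^ degree p"
    by (simp add: sum_distrib_right)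
qed (auto intro: sum_nonneg)

lemma filterlim_ray_at_infinity:
  fixes u :: complex
  assumes "norm u = 1"
  shows "filterlim (\<lambda>r. of_real r * u) at_infinity at_top"
proof (rule filterlim_norm_at_top_imp_at_infinity)
  have "\<forall>\<^sub>F r in at_top. r = norm (of_real r * u)"
    using eventually_ge_at_top[of 0] by eventually_elim (simp add: norm_mult assms)
  thus "filterlim (\<lambda>r. norm (of_real r * u)) at_top at_top"
    by (rule filterlim_mono_eventually[OF filterlim_ident order_refl order_refl])
qed

lemma poly_ray_asymptotics:
  fixes p :: "complex poly"
  assumes "norm u = 1"
  shows "((\<lambda>r. poly p (of_real r * u) / of_real r ^ degree p) \<longlongrightarrow> lead_coeff p * u ^ degree p) at_top"
proof -
  have "u \<noteq> 0" using assms by auto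
  have "((\<lambda>r. poly p (of_real r * u) / (of_real r * u) ^ degree p * u ^ degree p) \<longlongrightarrow> lead_coeff p * u ^ degree p) at_top"
    by (intro tendsto_mult tendsto_const filterlim_compose[OF poly_divide_tendsto_aux filterlim_ray_at_infinity] assms)
  thus ?thesis using \<open>u \<noteq> 0\<close> by (simp add: power_mult_distrib)
qed

lemma ray_has_vector_derivative:
  assumes "(f has_field_derivative f') (at (of_real r * u))"
  shows "((\<lambda>r. f (of_real r * u)) has_vector_derivative u * f') (at r)"
proof -
  have "((\<lambda>r. of_real r * u) has_vector_derivative u) (at r)"
    by (auto intro!: derivative_eq_intros)
  from field_vector_diff_chain_at[OF this assms] show ?thesis by (simp add: o_def)
qed

lemma continuous_on_ray:
  assumes "f holomorphic_on UNIV"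
  shows "continuous_on UNIV (\<lambda>r::real. f (of_real r * u))"
  by (rule continuous_on_compose2[OF holomorphic_on_imp_continuous_on[OF assms]]) (auto intro!: continuous_intros)

text \<open>
  All integrands below decay faster than \<open>exp (- r)\<close>, so one integrable majorant suffices for them.
\<close>

lemma set_integrable_exp_decay:
  fixes h :: "real \<Rightarrow> 'a::{banach, second_countable_topology}"
  assumes cont: "continuous_on {0..} h" and lim: "((\<lambda>r. exp r *\<^sub>R h r) \<longlongrightarrow> 0) at_top"
  shows "set_integrable lborel {0..} h"
proof -
  have "\<forall>\<^sub>F r in at_top. norm (exp r *\<^sub>R h r) < 1"
    using order_tendstoD(2)[OF tendsto_norm_zero[OF lim], of 1] by simp
  then obtain R where R: "\<And>r. r \<ge> R \<Longrightarrow> norm (exp r *\<^sub>R h r) < 1"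
    by (auto simp: eventually_at_top_linorder)
  have "compact ((\<lambda>r. exp r *\<^sub>R h r) ` {0..R})"
    by (intro compact_continuous_image continuous_intros continuous_on_subset[OF cont]) auto
  from compact_imp_bounded[OF this] obtain B where B: "\<And>r. r \<in> {0..R} \<Longrightarrow> norm (exp r *\<^sub>R h r) \<le> B"
    unfolding bounded_iff by blast
  define C where "C = max B 1"
  have C: "norm (h r) \<le> C * exp (- r)" if "r \<ge> 0" for r
  proof -
    have "norm (exp r *\<^sub>R h r) \<le> C"
      using that R[of r] B[of r] by (cases "r \<le> R") (auto simp: C_def le_max_iff_disj)
    thus ?thesis by (simp add: exp_minus field_simps)
  qed
  have "((\<lambda>x::real. - exp (- x)) \<longlongrightarrow> - 0) at_top"
    by (intro tendsto_minus filterlim_compose[OF exp_at_bot] filterlim_uminus_at_bot_at_top)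
  hence "(\<integral>\<^sup>+x. ennreal (exp (- x)) * indicator {0..} x \<partial>lborel) = ennreal (- 0 - (- exp (- 0)))"
    by (intro nn_integral_FTC_atLeast) (auto intro!: derivative_eq_intros)
  hence "integrable lborel (\<lambda>x::real. exp (- x) * indicator {0..} x)"
    by (intro integrableI_nonneg) (auto simp: ennreal_mult'' ennreal_indicator)
  hence "set_integrable lborel {0..} (\<lambda>r. C * exp (- r))"
    by (intro set_integrable_mult_right) (simp add: set_integrable_def mult.commute)
  thus ?thesis
  proof (rule set_integrable_bound)
    show "set_borel_measurable lborel {0..} h"
      using borel_measurable_continuous_on_indicator[OF _ cont] by (simp add: set_borel_measurable_def)
    show "AE x in lborel. x \<in> {0..} \<longrightarrow> norm (h x) \<le> norm (C * exp (- x))"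
      using C by (intro AE_I2) (auto intro!: order_trans[OF _ abs_ge_self] simp: abs_mult C_def)
  qed
qed

text \<open>
  Convergence of \<open>G\<close> is part of the conclusion: for the concomitants below, the limit at infinity
  is known to exist only because the derivative is integrable.
\<close>

lemma half_line_FTC:
  fixes G :: "real \<Rightarrow> 'a::euclidean_space"
  assumes G: "\<And>r. r \<ge> 0 \<Longrightarrow> (G has_vector_derivative g r) (at r)"
    and cont: "continuous_on {0..} g" and int: "set_integrable lborel {0..} g"
  shows "(G \<longlongrightarrow> G 0 + (LBINT r:{0..}. g r)) at_top"
proof -
  have lim: "((\<lambda>y. \<integral>x. indicator {..y} x *\<^sub>R (indicator {0..} x *\<^sub>R g x) \<partial>lborel) \<longlongrightarrow> (LBINT r:{0..}. g r)) at_top"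
    using tendsto_integral_at_top[OF _ int[unfolded set_integrable_def]] by (simp add: set_lebesgue_integral_def)
  have "\<forall>\<^sub>F y in at_top. (\<integral>x. indicator {..y} x *\<^sub>R (indicator {0..} x *\<^sub>R g x) \<partial>lborel) = G y - G 0"
    using eventually_ge_at_top[of 0]
  proof eventually_elim
    case (elim y)
    have "(\<integral>x. indicator {..y} x *\<^sub>R (indicator {0..} x *\<^sub>R g x) \<partial>lborel) = (\<integral>x. indicator {0..y} x *\<^sub>R g x \<partial>lborel)"
      by (intro Bochner_Integration.integral_cong) (auto split: split_indicator)
    also have "\<dots> = G y - G 0"
    proof (rule integral_FTC_atLeastAtMost[OF elim])
      show "(G has_vector_derivative g x) (at x within {0..y})" if "0 \<le> x" for x
        using that by (rule has_vector_derivative_at_within[OF G])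
      show "continuous_on {0..y} g" by (rule continuous_on_subset[OF cont]) auto
    qed
    finally show ?case .
  qed
  from Lim_transform_eventually[OF lim this]
  have "((\<lambda>y. G 0 + (G y - G 0)) \<longlongrightarrow> G 0 + (LBINT r:{0..}. g r)) at_top" by (intro tendsto_intros)
  thus ?thesis by simp
qed

lemma integrable_exp_decay:
  fixes h :: "real \<Rightarrow> 'a::{banach, second_countable_topology}"
  assumes cont: "continuous_on UNIV h"
    and "((\<lambda>r. exp r *\<^sub>R h r) \<longlongrightarrow> 0) at_top" "((\<lambda>r. exp r *\<^sub>R h (- r)) \<longlongrightarrow> 0) at_top"
  shows "integrable lborel h"
proof -
  have 1: "set_integrable lborel {0..} h"
    by (rule set_integrable_exp_decay[OF continuous_on_subset[OF cont] assms(2)]) auto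
  have "set_integrable lborel {0..} (\<lambda>r. h (- r))"
    by (rule set_integrable_exp_decay[OF continuous_on_compose2[OF cont] assms(3)]) (auto intro!: continuous_intros)
  hence "integrable lborel (\<lambda>r. indicator {0..} (- r) *\<^sub>R h (- (- r)))"
    unfolding set_integrable_def by (subst (asm) lborel_integrable_real_affine_iff[of "-1" _ 0, symmetric]) auto
  also have "(\<lambda>r. indicator {0..} (- r) *\<^sub>R h (- (- r))) = (\<lambda>r. indicator {..0::real} r *\<^sub>R h r)"
    by (auto simp: indicator_def)
  finally have 2: "set_integrable lborel {..0} h" by (simp add: set_integrable_def)
  have "set_integrable lborel ({..0} \<union> {0..}) h" using 1 2 by (intro set_integrable_Un) auto
  moreover have "{..0} \<union> {0..} = (UNIV :: real set)" by auto
  ultimately show ?thesis by (simp add: set_integrable_def)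
qed

lemma real_line_integral_derivative_eq_0:
  fixes H :: "real \<Rightarrow> 'a::euclidean_space"
  assumes H: "\<And>x. (H has_vector_derivative h x) (at x)"
    and cont: "continuous_on UNIV h" and int: "integrable lborel h"
    and lim: "(H \<longlongrightarrow> 0) at_top" "(H \<longlongrightarrow> 0) at_bot"
  shows "(LBINT x. h x) = 0"
proof -
  have "(LBINT x=-\<infinity>..\<infinity>. h x) = 0 - 0"
  proof (rule interval_integral_FTC_integrable[OF _ H])
    show "isCont h x" for x using cont by (simp add: continuous_on_eq_continuous_at)
    show "set_integrable lborel (einterval (- \<infinity>) \<infinity>) h" using int by (simp add: set_integrable_def)
  qed (use lim in \<open>auto simp: ereal_tendsto_simps\<close>)
  thus ?thesis by (simp add: interval_lebesgue_integral_def set_lebesgue_integral_def)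
qed

lemma norm_le_norm_exp_scaleR: "r \<ge> 0 \<Longrightarrow> norm x \<le> norm (exp r *\<^sub>R x)"
  using mult_right_mono[of 1 "exp r" "norm x"] by simp

lemma cpoly_of_real: "poly (cpoly p) (of_real x) = of_real (poly p x)"
  by (induction p) (auto simp: map_poly_pCons)

text \<open>
  The hypotheses on the potential alone; they control \<open>exp (- V)\<close> along every ray through the
  sign of \<open>Re (u ^ D)\<close>, where \<open>u\<close> is the direction of the ray.
\<close>

locale freud_weight =
  fixes D :: nat and \<gamma> :: real and V :: "real poly"
  assumes D4: "D \<ge> 4" and evenD: "even D" and degV: "degree V = D"
    and lcV: "lead_coeff V = \<gamma>" and \<gamma>pos: "\<gamma> > 0"
begin

lemma degree_cpolyV [simp]: "degree (cpoly V) = D" by (simp add: degV degree_map_poly)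
lemma lead_coeff_cpolyV [simp]: "coeff (cpoly V) D = of_real \<gamma>" using lcV degV by (simp add: coeff_map_poly)
lemma D_pos [simp]: "D > 0" using D4 by simp

lemma V_slope_on_ray:
  assumes "norm u = 1"
  shows "((\<lambda>r. Re (u * poly (cpoly (pderiv V)) (of_real r * u)) / r ^ (D - 1)) \<longlongrightarrow> real D * \<gamma> * Re (u ^ D)) at_top"
proof -
  have deg: "degree (cpoly (pderiv V)) = D - 1" by (simp add: degree_map_poly degree_pderiv degV)
  have lc: "lead_coeff (cpoly (pderiv V)) = of_real (real D * \<gamma>)"
    unfolding deg using lcV degV by (simp add: coeff_map_poly coeff_pderiv)
  have "((\<lambda>r. Re (u * (poly (cpoly (pderiv V)) (of_real r * u) / of_real r ^ (D - 1)))) \<longlongrightarrow> Re (u * (of_real (real D * \<gamma>) * u ^ (D - 1)))) at_top"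
    using poly_ray_asymptotics[OF assms, of "cpoly (pderiv V)"] unfolding deg[symmetric] lc[symmetric]
    by (intro tendsto_intros)
  also have "Re (u * (of_real (real D * \<gamma>) * u ^ (D - 1))) = Re (of_real (real D * \<gamma>) * u ^ D)"
    by (simp only: power_minus_mult[OF D_pos, of u, symmetric] mult_ac)
  also have "\<dots> = real D * \<gamma> * Re (u ^ D)" by (simp only: Re_complex_of_real times_complex.sel Im_complex_of_real mult_zero_left diff_zero)
  finally have *: "((\<lambda>r. Re (u * (poly (cpoly (pderiv V)) (of_real r * u) / of_real r ^ (D - 1)))) \<longlongrightarrow> real D * \<gamma> * Re (u ^ D)) at_top" .
  have "Re (u * (z / of_real r ^ n)) = Re (u * z) / r ^ n" for z r n
    by (metis Re_divide_of_real of_real_power times_divide_eq_right)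
  with * show ?thesis by simp
qed

lemma V_slope_at_top:
  assumes "norm u = 1" "Re (u ^ D) > 0"
  shows "filterlim (\<lambda>r. Re (u * poly (cpoly (pderiv V)) (of_real r * u))) at_top at_top"
proof -
  have "filterlim (\<lambda>r. Re (u * poly (cpoly (pderiv V)) (of_real r * u)) / r ^ (D - 1) * r ^ (D - 1)) at_top at_top"
    by (rule filterlim_tendsto_pos_mult_at_top[OF V_slope_on_ray])
      (use assms \<gamma>pos D4 in \<open>auto intro!: filterlim_pow_at_top filterlim_ident\<close>)
  thus ?thesis
    by (rule filterlim_mono_eventually[OF _ order_refl order_refl])
      (use eventually_gt_at_top[of 0] in eventually_elim, simp)
qed

lemma V_slope_le:
  assumes "norm u = 1" "Re (u ^ D) < 0"
  shows "\<forall>\<^sub>F r in at_top. Re (u * poly (cpoly (pderiv V)) (of_real r * u)) \<le> - r"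
proof -
  have "filterlim (\<lambda>r. Re (u * poly (cpoly (pderiv V)) (of_real r * u)) / r ^ (D - 1) * r ^ (D - 2)) at_bot at_top"
    by (rule filterlim_tendsto_neg_mult_at_bot[OF V_slope_on_ray])
      (use assms \<gamma>pos D4 in \<open>auto intro!: filterlim_pow_at_top filterlim_ident simp: mult_pos_neg\<close>)
  hence "\<forall>\<^sub>F r in at_top. Re (u * poly (cpoly (pderiv V)) (of_real r * u)) / r ^ (D - 1) * r ^ (D - 2) \<le> -1"
    by (simp add: filterlim_at_bot)
  thus ?thesis using eventually_gt_at_top[of 0]
  proof eventually_elim
    case (elim r)
    have "r ^ (D - 1) = r * r ^ (D - 2)" using D4 by (simp add: numeral_2_eq_2 Suc_diff_Suc flip: power_Suc)
    hence "Re (u * poly (cpoly (pderiv V)) (of_real r * u)) / r \<le> -1" using elim by simp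
    thus ?case using elim by (simp add: divide_le_eq)
  qed
qed

lemma V_ge_on_ray:
  assumes "norm u = 1" "Re (u ^ D) > 0"
  shows "\<forall>\<^sub>F r in at_top. Re (poly (cpoly V) (of_real r * u)) \<ge> 2 * r"
proof -
  have "((\<lambda>r. Re (poly (cpoly V) (of_real r * u) / of_real r ^ D)) \<longlongrightarrow> Re (of_real \<gamma> * u ^ D)) at_top"
    using poly_ray_asymptotics[OF assms(1), of "cpoly V"] unfolding degree_cpolyV lead_coeff_cpolyV
    by (intro tendsto_intros)
  hence "((\<lambda>r. Re (poly (cpoly V) (of_real r * u)) / r ^ D) \<longlongrightarrow> \<gamma> * Re (u ^ D)) at_top"
    by (simp flip: of_real_power)
  hence "filterlim (\<lambda>r. Re (poly (cpoly V) (of_real r * u)) / r ^ D * r ^ (D - 1)) at_top at_top"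
    by (rule filterlim_tendsto_pos_mult_at_top)
      (use assms \<gamma>pos D4 in \<open>auto intro!: filterlim_pow_at_top filterlim_ident\<close>)
  hence "\<forall>\<^sub>F r in at_top. Re (poly (cpoly V) (of_real r * u)) / r ^ D * r ^ (D - 1) \<ge> 2"
    by (simp add: filterlim_at_top)
  thus ?thesis using eventually_gt_at_top[of 0]
  proof eventually_elim
    case (elim r)
    have "r ^ D = r * r ^ (D - 1)" using D4 by (simp flip: power_Suc)
    hence "Re (poly (cpoly V) (of_real r * u)) / r \<ge> 2" using elim by simp
    thus ?case using elim by (simp add: le_divide_eq)
  qed
qed

lemma weight_decay_power:
  assumes "norm u = 1" "Re (u ^ D) > 0"
  shows "((\<lambda>r. exp r * r ^ N * exp (- Re (poly (cpoly V) (of_real r * u)))) \<longlongrightarrow> 0) at_top"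
proof (rule Lim_null_comparison)
  show "((\<lambda>r::real. r ^ N / exp r) \<longlongrightarrow> 0) at_top" by (rule tendsto_power_div_exp_0)
  show "\<forall>\<^sub>F r in at_top. norm (exp r * r ^ N * exp (- Re (poly (cpoly V) (of_real r * u)))) \<le> r ^ N / exp r"
    using V_ge_on_ray[OF assms] eventually_gt_at_top[of 0]
  proof eventually_elim
    case (elim r)
    have "exp r * r ^ N * exp (- Re (poly (cpoly V) (of_real r * u))) = r ^ N * exp (r - Re (poly (cpoly V) (of_real r * u)))"
      by (simp add: exp_diff exp_minus field_simps)
    also have "\<dots> \<le> r ^ N * exp (- r)" using elim by (intro mult_left_mono) auto
    finally show ?case using elim by (simp add: exp_minus divide_inverse)
  qed
qed

text \<open>
  The convergent factor \<open>g\<close> is there for the Sibuya solutions, which tend to \<open>1\<close> along their rays.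
\<close>

lemma weight_decay:
  assumes u: "norm u = 1" "Re (u ^ D) > 0" and g: "(g \<longlongrightarrow> c) at_top"
  shows "((\<lambda>r. exp r *\<^sub>R (g r * poly p (of_real r * u) * exp (- poly (cpoly V) (of_real r * u)))) \<longlongrightarrow> 0) at_top"
proof -
  have "((\<lambda>r. exp r * r ^ degree p * exp (- Re (poly (cpoly V) (of_real r * u))) *
         norm (g r * (poly p (of_real r * u) / of_real r ^ degree p))) \<longlongrightarrow> 0 * norm (c * (lead_coeff p * u ^ degree p))) at_top"
    by (intro tendsto_intros weight_decay_power u g poly_ray_asymptotics)
  hence "((\<lambda>r. exp r * r ^ degree p * exp (- Re (poly (cpoly V) (of_real r * u))) *
         norm (g r * (poly p (of_real r * u) / of_real r ^ degree p))) \<longlongrightarrow> 0) at_top" by simp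
  moreover have "\<forall>\<^sub>F r in at_top. exp r * r ^ degree p * exp (- Re (poly (cpoly V) (of_real r * u))) *
         norm (g r * (poly p (of_real r * u) / of_real r ^ degree p)) =
         norm (exp r *\<^sub>R (g r * poly p (of_real r * u) * exp (- poly (cpoly V) (of_real r * u))))"
    using eventually_gt_at_top[of 0]
  proof eventually_elim
    case (elim r)
    have 1: "norm (exp r *\<^sub>R (x * y * exp z)) = exp r * (norm x * norm y * exp (Re z))" for x y z :: complex
      by (simp add: norm_mult)
    have 2: "norm (x * (y / of_real r ^ n)) = norm x * norm y / r ^ n" for x y :: complex and n
      using elim by (simp add: norm_mult norm_divide norm_power)
    have 3: "(e * R * E) * (x / R) = e * (x * E)" if "R \<noteq> 0" for e R E x :: real
      using that by simp
    show ?case unfolding 1 2 uminus_complex.sel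
      by (rule 3) (use elim in simp)
  qed
  ultimately show ?thesis by (rule tendsto_norm_zero_cancel[OF Lim_transform_eventually])
qed

lemma weighted_poly_tendsto_0:
  assumes u: "norm u = 1" "Re (u ^ D) > 0" and g: "(g \<longlongrightarrow> c) at_top"
  shows "((\<lambda>r. g r * poly p (of_real r * u) * exp (- poly (cpoly V) (of_real r * u))) \<longlongrightarrow> 0) at_top"
proof (rule Lim_null_comparison)
  show "((\<lambda>r. norm (exp r *\<^sub>R (g r * poly p (of_real r * u) * exp (- poly (cpoly V) (of_real r * u))))) \<longlongrightarrow> 0) at_top"
    by (intro tendsto_norm_zero weight_decay[OF assms])
  show "\<forall>\<^sub>F r in at_top. norm (g r * poly p (of_real r * u) * exp (- poly (cpoly V) (of_real r * u)))
    \<le> norm (exp r *\<^sub>R (g r * poly p (of_real r * u) * exp (- poly (cpoly V) (of_real r * u))))"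
    using eventually_ge_at_top[of 0] by eventually_elim (rule norm_le_norm_exp_scaleR)
qed

lemma real_weight_decay:
  fixes p :: "real poly"
  shows "((\<lambda>r. exp r *\<^sub>R (poly p r * exp (- poly V r))) \<longlongrightarrow> 0) at_top"
    and "((\<lambda>r. exp r *\<^sub>R (poly p (- r) * exp (- poly V (- r)))) \<longlongrightarrow> 0) at_top"
proof -
  have *: "((\<lambda>r. exp r *\<^sub>R (poly p (r * s) * exp (- poly V (r * s)))) \<longlongrightarrow> 0) at_top" if "s = 1 \<or> s = -1" for s :: real
  proof -
    have "((\<lambda>r. exp r *\<^sub>R (1 * poly (cpoly p) (of_real r * of_real s) * exp (- poly (cpoly V) (of_real r * of_real s)))) \<longlongrightarrow> 0) at_top"
      using that evenD by (intro weight_decay[OF _ _ tendsto_const]) auto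
    hence "((\<lambda>r. complex_of_real (exp r *\<^sub>R (poly p (r * s) * exp (- poly V (r * s))))) \<longlongrightarrow> of_real 0) at_top"
      by (simp add: cpoly_of_real scaleR_conv_of_real exp_of_real flip: of_real_mult of_real_minus)
    thus ?thesis by (rule tendsto_of_real_iff[THEN iffD1])
  qed
  show "((\<lambda>r. exp r *\<^sub>R (poly p r * exp (- poly V r))) \<longlongrightarrow> 0) at_top"
    "((\<lambda>r. exp r *\<^sub>R (poly p (- r) * exp (- poly V (- r)))) \<longlongrightarrow> 0) at_top"
    using *[of 1] *[of "-1"] by simp_all
qed

lemma integrable_weight: "integrable lborel (\<lambda>x. poly p x * exp (- poly V x))"
  by (rule integrable_exp_decay[OF _ real_weight_decay]) (intro continuous_intros)

lemma weight_vanishes: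
  "((\<lambda>x. poly p x * exp (- poly V x)) \<longlongrightarrow> 0) at_top" "((\<lambda>x. poly p x * exp (- poly V x)) \<longlongrightarrow> 0) at_bot"
proof -
  have *: "(h \<longlongrightarrow> 0) at_top" if "((\<lambda>r. exp r *\<^sub>R h r) \<longlongrightarrow> 0) at_top" for h :: "real \<Rightarrow> real"
  proof (rule Lim_null_comparison[OF _ tendsto_norm_zero[OF that]])
    show "\<forall>\<^sub>F r in at_top. norm (h r) \<le> norm (exp r *\<^sub>R h r)"
      using eventually_ge_at_top[of 0] by eventually_elim (rule norm_le_norm_exp_scaleR)
  qed
  show "((\<lambda>x. poly p x * exp (- poly V x)) \<longlongrightarrow> 0) at_top" by (rule *[OF real_weight_decay(1)])
  show "((\<lambda>x. poly p x * exp (- poly V x)) \<longlongrightarrow> 0) at_bot"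
    unfolding filterlim_at_bot_mirror by (rule *[OF real_weight_decay(2)])
qed

end

section \<open>Sobolev orthogonal polynomials and their differential operator\<close>

definition sobolev_op :: "'a::idom poly \<Rightarrow> 'a \<Rightarrow> 'a poly \<Rightarrow> 'a poly" where
  "sobolev_op V c P = pderiv V * pderiv P - pderiv (pderiv P) + smult c P"

lemma sobolev_op_add: "sobolev_op V c (P + Q) = sobolev_op V c P + sobolev_op V c Q"
  by (simp add: sobolev_op_def pderiv_add algebra_simps smult_add_right)

lemma sobolev_op_smult: "sobolev_op V c (smult a P) = smult a (sobolev_op V c P)"
  by (simp add: sobolev_op_def pderiv_smult smult_add_right smult_diff_right mult.commute)

lemma sobolev_op_diff: "sobolev_op V c (P - Q) = sobolev_op V c P - sobolev_op V c Q"
  using sobolev_op_add[of V c "P - Q" Q] by (simp add: algebra_simps)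

lemma cpoly_add: "cpoly (p + q) = cpoly p + cpoly q"
  and cpoly_diff: "cpoly (p - q) = cpoly p - cpoly q"
  and cpoly_smult: "cpoly (smult a p) = smult (of_real a) (cpoly p)"
  by (simp_all add: poly_eq_iff coeff_map_poly)

lemma cpoly_mult: "cpoly (p * q) = cpoly p * cpoly q"
  by (simp add: poly_eq_iff coeff_map_poly coeff_mult)

lemma cpoly_pderiv: "cpoly (pderiv p) = pderiv (cpoly p)"
  by (simp add: poly_eq_iff coeff_pderiv coeff_map_poly)

lemma cpoly_sobolev_op: "cpoly (sobolev_op V c P) = sobolev_op (cpoly V) (of_real c) (cpoly P)"
  by (simp add: sobolev_op_def cpoly_add cpoly_diff cpoly_mult cpoly_smult cpoly_pderiv)

lemma degree_sobolev_op:
  fixes P :: "'a::field_char_0 poly"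
  assumes V: "degree V \<ge> 3" and P: "degree P \<ge> 1"
  shows "degree (sobolev_op V c P) = degree P + degree V - 2"
    and "lead_coeff (sobolev_op V c P) = of_nat (degree V) * of_nat (degree P) * lead_coeff V * lead_coeff P"
proof -
  let ?A = "pderiv V * pderiv P" and ?B = "smult c P - pderiv (pderiv P)"
  have ne: "pderiv V \<noteq> 0" "pderiv P \<noteq> 0" using V P by (auto simp: pderiv_eq_0_iff)
  have lc: "lead_coeff (pderiv p) = of_nat (degree p) * lead_coeff p" if "degree p \<ge> 1" for p :: "'a poly"
    using that by (simp add: degree_pderiv coeff_pderiv)
  have dA: "degree ?A = degree P + degree V - 2"
    using ne V P by (simp add: degree_mult_eq degree_pderiv)
  have "degree ?B \<le> degree P"
    by (intro degree_diff_le) (auto simp: degree_pderiv intro: order_trans[OF degree_smult_le])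
  also have "\<dots> < degree ?A" using V P dA by simp
  finally have less: "degree ?B < degree ?A" .
  have eq: "sobolev_op V c P = ?B + ?A" by (simp add: sobolev_op_def)
  show "degree (sobolev_op V c P) = degree P + degree V - 2"
    unfolding eq using degree_add_eq_right[OF less] dA by simp
  have "lead_coeff (sobolev_op V c P) = lead_coeff (pderiv V) * lead_coeff (pderiv P)"
    unfolding eq using lead_coeff_add_le[OF less] by (simp add: lead_coeff_mult)
  thus "lead_coeff (sobolev_op V c P) = of_nat (degree V) * of_nat (degree P) * lead_coeff V * lead_coeff P"
    using V P by (simp add: lc)
qed

text \<open>
  The vanishing of all coefficients from index \<open>n\<close> on expresses "degree less than \<open>n\<close>" in a
  form that includes the zero polynomial and that is meaningful for \<open>n = 0\<close>.
\<close>

lemma monic_basis_span: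
  fixes P :: "nat \<Rightarrow> 'a::comm_ring_1 poly"
  assumes monic: "\<And>m. m < n \<Longrightarrow> degree (P m) = m \<and> coeff (P m) m = 1"
    and S: "0 \<in> S" "\<And>p q. p \<in> S \<Longrightarrow> q \<in> S \<Longrightarrow> p + q \<in> S" "\<And>c p. p \<in> S \<Longrightarrow> smult c p \<in> S"
      "\<And>m. m < n \<Longrightarrow> P m \<in> S"
    and q: "\<And>i. i \<ge> n \<Longrightarrow> coeff q i = 0"
  shows "q \<in> S"
  using monic S(4) q
proof (induction n arbitrary: q)
  case 0
  hence "q = 0" by (intro poly_eqI) simp
  thus ?case using S(1) by simp
next
  case (Suc n)
  define r where "r = q - smult (coeff q n) (P n)"
  have "coeff r i = 0" if "i \<ge> n" for i
  proof (cases "i = n")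
    case True
    have "coeff (P n) n = 1" using Suc.prems(1)[of n] by auto
    thus ?thesis using True by (simp add: r_def)
  next
    case False
    hence "coeff (P n) i = 0" using Suc.prems(1)[of n] that by (intro coeff_eq_0) simp
    thus ?thesis using False that Suc.prems(3)[of i] by (simp add: r_def)
  qed
  hence "r \<in> S" by (rule Suc.IH[rotated 2]) (use Suc.prems(1,2) less_SucI in blast)+
  moreover have "q = r + smult (coeff q n) (P n)" by (simp add: r_def)
  ultimately show ?case using S(2,3) Suc.prems(2)[of n] by (metis lessI)
qed

locale sobolev_weight = freud_weight +
  fixes lam :: real
  assumes lam_pos: "lam > 0"
begin

definition moment :: "real poly \<Rightarrow> real" where
  "moment p = (LBINT x. poly p x * exp (- poly V x))"

lemma moment_add: "moment (p + q) = moment p + moment q"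
  unfolding moment_def using Bochner_Integration.integral_add[OF integrable_weight[of p] integrable_weight[of q]]
  by (simp add: algebra_simps)

lemma moment_smult: "moment (smult c p) = c * moment p"
  unfolding moment_def by (simp add: mult.assoc)

lemma moment_0 [simp]: "moment 0 = 0" by (simp add: moment_def)

lemma moment_diff: "moment (p - q) = moment p - moment q"
  using moment_add[of "p - q" q] by simp

text \<open>
  A nonnegative integrand with vanishing integral is zero almost everywhere, but the zeros of a
  nonzero polynomial form a finite set.
\<close>

lemma moment_square_pos:
  assumes "p \<noteq> 0"
  shows "moment (p * p) > 0"
proof -
  let ?f = "\<lambda>x. poly (p * p) x * exp (- poly V x)"
  have nonneg: "0 \<le> ?f x" for x by simp
  have "moment (p * p) \<ge> 0" unfolding moment_def by (rule Bochner_Integration.integral_nonneg) (use nonneg in auto)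
  moreover have "moment (p * p) \<noteq> 0"
  proof
    assume "moment (p * p) = 0"
    hence "AE x in lborel. ?f x = 0"
      unfolding moment_def using integral_nonneg_eq_0_iff_AE[OF integrable_weight[of "p * p"]] nonneg by auto
    hence "AE x in lborel. poly p x = 0" by simp
    moreover have "AE x in lborel. x \<notin> {x. poly p x = 0}"
      using poly_roots_finite[OF assms] by (intro AE_not_in finite_imp_null_set_lborel)
    ultimately have "AE x in (lborel :: real measure). False" by eventually_elim simp
    thus False by (simp add: AE_iff_null emeasure_lborel_UNIV null_sets_def)
  qed
  ultimately show ?thesis by simp
qed

lemma sobolev_inner_moment:
  "sobolev_inner V lam P Q = moment (P * Q) + lam * moment (pderiv P * pderiv Q)"
  by (simp add: sobolev_inner_def moment_def)

lemma moment_integration_by_parts: "moment (pderiv p) = moment (pderiv V * p)"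
proof -
  have "(LBINT x. poly (pderiv p - pderiv V * p) x * exp (- poly V x)) = 0"
  proof (rule real_line_integral_derivative_eq_0[where H = "\<lambda>x. poly p x * exp (- poly V x)"])
    fix x
    show "((\<lambda>x. poly p x * exp (- poly V x)) has_vector_derivative
             poly (pderiv p - pderiv V * p) x * exp (- poly V x)) (at x)"
      unfolding has_real_derivative_iff_has_vector_derivative[symmetric]
      by (auto intro!: derivative_eq_intros simp: algebra_simps)
  qed (intro continuous_intros integrable_weight weight_vanishes)+
  hence "moment (pderiv p - pderiv V * p) = 0" by (simp only: moment_def)
  thus ?thesis by (simp add: moment_diff)
qed

text \<open>
  Sobolev orthogonality to \<open>P\<close> is ordinary weighted orthogonality to \<open>L P\<close>: integrate the
  derivative term by parts.
\<close>

lemma sobolev_inner_eq_moment_op: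
  "sobolev_inner V lam P Q = lam * moment (Q * sobolev_op V (1 / lam) P)"
proof -
  have "Q * sobolev_op V (1 / lam) P = pderiv V * (Q * pderiv P) - pderiv (Q * pderiv P)
          + pderiv P * pderiv Q + smult (1 / lam) (P * Q)"
    by (simp add: sobolev_op_def pderiv_mult algebra_simps)
  hence "moment (Q * sobolev_op V (1 / lam) P) = moment (pderiv P * pderiv Q) + 1 / lam * moment (P * Q)"
    using moment_integration_by_parts[of "Q * pderiv P"]
    by (simp only: moment_add moment_diff moment_smult diff_self add_0)
  thus ?thesis using lam_pos by (simp add: sobolev_inner_moment distrib_left)
qed

lemma sobolev_inner_commute: "sobolev_inner V lam P Q = sobolev_inner V lam Q P"
  by (simp add: sobolev_inner_moment mult.commute)

lemma sobolev_inner_linear: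
  "sobolev_inner V lam P 0 = 0"
  "sobolev_inner V lam P (Q + R) = sobolev_inner V lam P Q + sobolev_inner V lam P R"
  "sobolev_inner V lam P (smult c Q) = c * sobolev_inner V lam P Q"
  "sobolev_inner V lam P (Q - R) = sobolev_inner V lam P Q - sobolev_inner V lam P R"
  by (simp_all add: sobolev_inner_moment pderiv_add pderiv_diff pderiv_smult moment_add moment_diff moment_smult algebra_simps)

lemma sobolev_inner_sum:
  "sobolev_inner V lam P (\<Sum>i\<in>A. Q i) = (\<Sum>i\<in>A. sobolev_inner V lam P (Q i))"
  by (induction A rule: infinite_finite_induct) (simp_all add: sobolev_inner_linear)

lemma sobolev_inner_pos: "P \<noteq> 0 \<Longrightarrow> sobolev_inner V lam P P > 0"
  unfolding sobolev_inner_moment using moment_square_pos[of P] moment_square_pos[of "pderiv P"] lam_pos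
  by (cases "pderiv P = 0") (auto intro: add_pos_nonneg)

lemma sobolev_orthogonal_to_lower:
  assumes "\<And>m. m < n \<Longrightarrow> degree (P m) = m \<and> coeff (P m) m = 1"
    and "\<And>m. m < n \<Longrightarrow> sobolev_inner V lam p (P m) = 0"
    and "\<And>i. i \<ge> n \<Longrightarrow> coeff q i = 0"
  shows "sobolev_inner V lam p q = 0"
proof -
  have "q \<in> {q. sobolev_inner V lam p q = 0}"
    by (rule monic_basis_span[OF assms(1)]) (use assms(2,3) in \<open>simp_all add: sobolev_inner_linear\<close>)
  thus ?thesis by simp
qed

lemma is_sobolev_ops_iff:
  "is_sobolev_ops V lam P \<longleftrightarrow> (\<forall>n. degree (P n) = n \<and> coeff (P n) n = 1) \<and>
     (\<forall>n m. n \<noteq> m \<longrightarrow> sobolev_inner V lam (P n) (P m) = 0)"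
  unfolding is_sobolev_ops_def by metis

text \<open>
  Gram-Schmidt orthogonalisation of the monomials. The induction carries orthogonality to every
  polynomial of lower degree, from which orthogonality of the sequence follows by symmetry.
\<close>

lemma sobolev_ops_exists: "\<exists>P. is_sobolev_ops V lam P"
proof -
  define good where "good n p \<longleftrightarrow> degree p = n \<and> coeff p n = 1 \<and>
     (\<forall>q. (\<forall>i\<ge>n. coeff q i = 0) \<longrightarrow> sobolev_inner V lam p q = 0)" for n and p :: "real poly"
  have "\<exists>p. good n p" for n
  proof (induction n rule: less_induct)
    case (less n)
    then obtain P where P: "\<And>m. m < n \<Longrightarrow> good m (P m)" by metis
    have orth: "sobolev_inner V lam (P m) (P k) = 0" if "m < n" "k < n" "m \<noteq> k" for m k
    proof -
      have *: "sobolev_inner V lam (P m) (P k) = 0" if "k < m" "m < n" for m k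
      proof -
        have "\<forall>i\<ge>m. coeff (P k) i = 0" using P[of k] that by (auto simp: good_def intro!: coeff_eq_0)
        thus ?thesis using P[of m] that by (auto simp: good_def)
      qed
      show ?thesis using *[of k m] *[of m k] that sobolev_inner_commute[of "P m" "P k"] by (cases "m < k") auto
    qed
    have ne: "P m \<noteq> 0" if "m < n" for m using P[OF that] by (auto simp: good_def)
    define s where "s = (\<Sum>m<n. smult (sobolev_inner V lam (monom 1 n) (P m) / sobolev_inner V lam (P m) (P m)) (P m))"
    define p where "p = monom 1 n - s"
    have s_coeff: "coeff s i = 0" if "i \<ge> n" for i
      unfolding s_def coeff_sum
    proof (rule sum.neutral, rule ballI)
      fix m assume "m \<in> {..<n}"
      hence "coeff (P m) i = 0" using P[of m] that by (intro coeff_eq_0) (auto simp: good_def)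
      thus "coeff (smult (sobolev_inner V lam (monom 1 n) (P m) / sobolev_inner V lam (P m) (P m)) (P m)) i = 0" by simp
    qed
    have "coeff p n = 1" "\<And>i. i > n \<Longrightarrow> coeff p i = 0" by (auto simp: p_def s_coeff)
    hence deg: "degree p = n" by (intro antisym degree_le le_degree) auto
    have "sobolev_inner V lam p (P k) = 0" if k: "k < n" for k
    proof -
      have "sobolev_inner V lam (P k) s = (\<Sum>m<n. if m = k then sobolev_inner V lam (monom 1 n) (P k) else 0)"
        unfolding s_def sobolev_inner_sum
      proof (rule sum.cong[OF refl])
        fix m assume "m \<in> {..<n}"
        thus "sobolev_inner V lam (P k) (smult (sobolev_inner V lam (monom 1 n) (P m) / sobolev_inner V lam (P m) (P m)) (P m))
           = (if m = k then sobolev_inner V lam (monom 1 n) (P k) else 0)"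
          using orth[of k m] k sobolev_inner_pos[OF ne[OF k]] by (auto simp: sobolev_inner_linear)
      qed
      also have "\<dots> = sobolev_inner V lam (monom 1 n) (P k)" using k by simp
      finally have "sobolev_inner V lam (P k) p = 0"
        by (simp add: p_def sobolev_inner_linear sobolev_inner_commute)
      thus ?thesis by (simp add: sobolev_inner_commute)
    qed
    hence "\<forall>q. (\<forall>i\<ge>n. coeff q i = 0) \<longrightarrow> sobolev_inner V lam p q = 0"
    proof (intro allI impI)
      fix q :: "real poly" assume p_orth: "\<And>k. k < n \<Longrightarrow> sobolev_inner V lam p (P k) = 0" and "\<forall>i\<ge>n. coeff q i = 0"
      show "sobolev_inner V lam p q = 0"
        by (rule sobolev_orthogonal_to_lower[of n P p q])
          (use P p_orth \<open>\<forall>i\<ge>n. coeff q i = 0\<close> in \<open>simp_all add: good_def\<close>)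
    qed
    thus ?case using deg \<open>coeff p n = 1\<close> by (auto simp: good_def)
  qed
  then obtain P where P: "\<And>n. good n (P n)" by metis
  have *: "sobolev_inner V lam (P n) (P m) = 0" if "m < n" for n m
  proof -
    have "\<forall>i\<ge>n. coeff (P m) i = 0" using P[of m] that by (auto simp: good_def intro!: coeff_eq_0)
    thus ?thesis using P[of n] by (auto simp: good_def)
  qed
  have "sobolev_inner V lam (P n) (P m) = 0" if "n \<noteq> m" for n m
    using *[of n m] *[of m n] that sobolev_inner_commute[of "P m" "P n"] by (cases "m < n") auto
  hence "is_sobolev_ops V lam P" using P by (simp add: is_sobolev_ops_iff good_def)
  thus ?thesis by blast
qed

lemma sobolev_ops_orthogonal:
  assumes "is_sobolev_ops V lam P" "\<And>i. i \<ge> n \<Longrightarrow> coeff q i = 0"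
  shows "sobolev_inner V lam (P n) q = 0"
proof (rule sobolev_orthogonal_to_lower[of n P])
qed (use assms in \<open>simp_all add: is_sobolev_ops_iff\<close>)

lemma sobolev_ops_unique:
  assumes P: "is_sobolev_ops V lam P" and Q: "is_sobolev_ops V lam Q"
  shows "P = Q"
proof
  fix n
  have "coeff (P n - Q n) i = 0" if "i \<ge> n" for i
  proof (cases "i = n")
    case True
    thus ?thesis using P Q by (simp add: is_sobolev_ops_iff)
  next
    case False
    hence "coeff (P n) i = 0" "coeff (Q n) i = 0" using P Q that by (auto simp: is_sobolev_ops_iff intro!: coeff_eq_0)
    thus ?thesis by simp
  qed
  from sobolev_ops_orthogonal[OF P this] sobolev_ops_orthogonal[OF Q this]
  have "sobolev_inner V lam (P n - Q n) (P n - Q n) = 0"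
    by (metis sobolev_inner_commute sobolev_inner_linear(4) diff_self)
  thus "P n = Q n" using sobolev_inner_pos[of "P n - Q n"] by auto
qed

lemma is_sobolev_ops_sobolev_poly: "is_sobolev_ops V lam (sobolev_poly V lam)"
  proof -
  have "\<exists>!P. is_sobolev_ops V lam P" using sobolev_ops_exists sobolev_ops_unique by blast
  from theI'[OF this] show ?thesis by (simp only: sobolev_poly_def)
qed

lemma degree_sobolev_poly [simp]: "degree (sobolev_poly V lam n) = n"
  and lead_coeff_sobolev_poly [simp]: "coeff (sobolev_poly V lam n) n = 1"
  using is_sobolev_ops_sobolev_poly by (simp_all add: is_sobolev_ops_iff)

lemma dual_poly_eq:
  "dual_poly D \<gamma> V lam n = smult (dual_norm D \<gamma> lam n) (sobolev_op V (1 / lam) (sobolev_poly V lam n))"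
  by (simp add: dual_poly_def sobolev_op_def Let_def)

lemma dual_poly_monic:
  assumes "n \<ge> 1"
  shows "degree (dual_poly D \<gamma> V lam n) = n + D - 2" "lead_coeff (dual_poly D \<gamma> V lam n) = 1"
proof -
  have ne: "dual_norm D \<gamma> lam n \<noteq> 0" using assms \<gamma>pos D4 by (simp add: dual_norm_def)
  note * = degree_sobolev_op[of V "sobolev_poly V lam n" "1 / lam"]
  show "degree (dual_poly D \<gamma> V lam n) = n + D - 2"
    unfolding dual_poly_eq using * ne assms D4 by (simp add: degV)
  have "lead_coeff (sobolev_op V (1 / lam) (sobolev_poly V lam n)) = real D * real n * \<gamma>"
    using *(2) assms D4 lcV by (simp add: degV)
  thus "lead_coeff (dual_poly D \<gamma> V lam n) = 1"
    unfolding dual_poly_eq lead_coeff_smult using assms D4 \<gamma>pos by (simp add: dual_norm_def)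
qed

lemma poly_complex_of_real_Re_Im:
  "poly p (of_real x) = of_real (poly (map_poly Re p) x) + \<i> * of_real (poly (map_poly Im p) x)"
  by (induction p) (auto simp: map_poly_pCons complex_eq_iff)

lemma integrable_complex_weight:
  "integrable lborel (\<lambda>x. poly p (of_real x) * of_real (exp (- poly V x)) :: complex)"
proof -
  have "(\<lambda>x. poly p (of_real x) * of_real (exp (- poly V x))) =
      (\<lambda>x. complex_of_real (poly (map_poly Re p) x * exp (- poly V x)) + \<i> * of_real (poly (map_poly Im p) x * exp (- poly V x)))"
    unfolding poly_complex_of_real_Re_Im by (simp add: algebra_simps)
  thus ?thesis
    by (simp del: of_real_mult) (intro Bochner_Integration.integrable_add integrable_of_real integrable_mult_right integrable_weight)
qed

lemma complex_moment:
  "(LBINT x. poly p (of_real x) * of_real (exp (- poly V x))) =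
     of_real (moment (map_poly Re p)) + \<i> * of_real (moment (map_poly Im p))"
proof -
  have "(LBINT x. poly p (of_real x) * of_real (exp (- poly V x))) =
    (LBINT x. complex_of_real (poly (map_poly Re p) x * exp (- poly V x))
              + \<i> * of_real (poly (map_poly Im p) x * exp (- poly V x)))"
    unfolding poly_complex_of_real_Re_Im by (simp add: algebra_simps)
  also have "\<dots> = of_real (moment (map_poly Re p)) + \<i> * of_real (moment (map_poly Im p))"
    unfolding moment_def
    by (subst Bochner_Integration.integral_add)
      (auto simp del: of_real_mult intro!: integrable_of_real integrable_weight integrable_mult_right simp: integral_complex_of_real)
  finally show ?thesis .
qed

lemma dual_poly_orthogonal:
  assumes "k < n"
  shows "(LBINT x. of_real x ^ k * poly (cpoly (dual_poly D \<gamma> V lam n)) (of_real x) * of_real (exp (- poly V x))) = (0::complex)"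
proof -
  have "sobolev_inner V lam (sobolev_poly V lam n) (monom 1 k) = 0"
    using assms by (intro sobolev_ops_orthogonal[OF is_sobolev_ops_sobolev_poly]) simp
  hence "moment (monom 1 k * dual_poly D \<gamma> V lam n) = 0"
    using lam_pos by (simp add: sobolev_inner_eq_moment_op dual_poly_eq moment_smult)
  moreover have "of_real x ^ k * poly (cpoly (dual_poly D \<gamma> V lam n)) (of_real x) * of_real (exp (- poly V x)) =
     complex_of_real (poly (monom 1 k * dual_poly D \<gamma> V lam n) x * exp (- poly V x))" for x
    by (simp add: cpoly_of_real poly_monom)
  ultimately show ?thesis unfolding moment_def by (simp only: integral_complex_of_real of_real_0)
qed

text \<open>
  This is the positivity that makes the solution of the problem unique. The weight is real, so the
  real and the imaginary part of \<open>g\<close> satisfy the same conditions; each of them is Sobolev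
  orthogonal to all polynomials of degree less than \<open>n\<close>, in particular to itself.
\<close>

lemma eq_0_if_sobolev_op_orthogonal:
  fixes g :: "complex poly"
  assumes deg: "\<And>i. i \<ge> n \<Longrightarrow> coeff g i = 0"
    and orth: "\<And>k. k < n \<Longrightarrow> (LBINT x. of_real x ^ k * poly (sobolev_op (cpoly V) (of_real (1 / lam)) g) (of_real x) * of_real (exp (- poly V x))) = 0"
  shows "g = 0"
proof -
  define a where "a = map_poly Re g"
  define b where "b = map_poly Im g"
  have g: "g = cpoly a + smult \<i> (cpoly b)"
    by (simp add: poly_eq_iff a_def b_def coeff_map_poly complex_eq_iff)
  let ?L = "sobolev_op V (1 / lam)"
  have op_g: "sobolev_op (cpoly V) (of_real (1 / lam)) g = cpoly (?L a) + smult \<i> (cpoly (?L b))"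
    by (simp only: g sobolev_op_add sobolev_op_smult cpoly_sobolev_op)
  have mom: "moment (monom 1 k * ?L a) = 0 \<and> moment (monom 1 k * ?L b) = 0" if "k < n" for k
  proof -
    let ?p = "monom 1 k * sobolev_op (cpoly V) (of_real (1 / lam)) g"
    have "?p = cpoly (monom 1 k * ?L a) + smult \<i> (cpoly (monom 1 k * ?L b))"
      unfolding op_g by (simp add: cpoly_mult map_poly_monom algebra_simps)
    hence ReIm: "map_poly Re ?p = monom 1 k * ?L a" "map_poly Im ?p = monom 1 k * ?L b"
      by (simp_all add: poly_eq_iff coeff_map_poly del: mult_monom)
    have "(LBINT x. poly ?p (of_real x) * of_real (exp (- poly V x))) = 0"
      using orth[OF that] by (simp add: poly_monom mult.assoc)
    thus ?thesis unfolding complex_moment ReIm by (simp add: complex_eq_iff)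
  qed
  have *: "p = 0" if p: "\<And>i. i \<ge> n \<Longrightarrow> coeff p i = 0" "\<And>k. k < n \<Longrightarrow> moment (monom 1 k * ?L p) = 0" for p
  proof -
    have "sobolev_inner V lam p p = 0"
    proof (rule sobolev_orthogonal_to_lower[of n "\<lambda>k. monom 1 k"])
    qed (use p lam_pos in \<open>simp_all add: degree_monom_eq sobolev_inner_eq_moment_op\<close>)
    thus ?thesis using sobolev_inner_pos[of p] by auto
  qed
  have "a = 0" "b = 0" by (rule *; use mom deg in \<open>simp add: a_def b_def coeff_map_poly\<close>)+
  thus ?thesis by (simp add: g)
qed

end

section \<open>Sibuya solutions along their rays\<close>

text \<open>
  Since \<open>\<phi> z / z \<rightarrow> 1\<close>, a far point of the central ray is mapped by \<open>\<phi>\<close> close to that ray in argument, so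
  the ray eventually lies in the sector in which the expansion of \<open>F\<close> holds.
\<close>

lemma sibuya_ray_limit:
  assumes chart: "sibuya_chart D \<gamma> V \<rho> \<phi> \<psi>" and F: "is_sibuya_F D V lam \<rho> \<psi> k F" and D: "D > 2"
  shows "((\<lambda>r. F (of_real r * cis (pi * real k / real D))) \<longlongrightarrow> 1) at_top"
proof -
  define u where "u = cis (pi * real k / real D)"
  define S where "S = sibuya_sector D \<rho> \<psi> k"
  have u: "norm u = 1" by (simp add: u_def)
  note ray = filterlim_ray_at_infinity[OF u]
  have \<rho>: "\<rho> > 0" and bigo: "(\<lambda>z. \<phi> z / z - 1) \<in> O[at_infinity](\<lambda>z. 1 / z)"
    and inv: "\<forall>\<^sub>F z in at_infinity. \<psi> (\<phi> z) = z"
    and size: "\<forall>z. norm z \<ge> \<rho> \<longrightarrow> norm z / 2 \<le> norm (\<phi> z)"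
    using chart unfolding sibuya_chart_def by blast+
  from bigo obtain c where c: "\<forall>\<^sub>F z in at_infinity. norm (\<phi> z / z - 1) \<le> c * norm (1 / z)"
    by (rule landau_o.bigE)
  have "((\<lambda>z. \<phi> z / z - 1) \<longlongrightarrow> 0) at_infinity"
  proof (rule Lim_null_comparison[OF c])
    have "((\<lambda>z::complex. c * norm (inverse z)) \<longlongrightarrow> c * norm (0::complex)) at_infinity"
      by (intro tendsto_intros tendsto_inverse_0)
    thus "((\<lambda>z::complex. c * norm (1 / z)) \<longlongrightarrow> 0) at_infinity" by (simp add: inverse_eq_divide)
  qed
  hence "((\<lambda>z. \<phi> z / z - 1 + 1) \<longlongrightarrow> 0 + 1) at_infinity" by (intro tendsto_intros)
  hence lim1: "((\<lambda>z. \<phi> z / z) \<longlongrightarrow> 1) at_infinity" by simp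
  have "isCont Arg 1" by (rule continuous_at_Arg) (auto simp: complex_nonpos_Reals_iff)
  from isCont_tendsto_compose[OF this lim1] have "((\<lambda>z. Arg (\<phi> z / z)) \<longlongrightarrow> 0) at_infinity" by simp
  hence arg: "\<forall>\<^sub>F z in at_infinity. dist (Arg (\<phi> z / z)) 0 < pi / real D"
    by (rule tendstoD) (use D in simp)
  have "\<forall>\<^sub>F r in at_top. of_real r * u \<in> S"
    using eventually_ge_at_top[of "2 * \<rho>"]
      eventually_compose_filterlim[OF inv ray] eventually_compose_filterlim[OF arg ray]
  proof eventually_elim
    case (elim r)
    define z where "z = of_real r * u"
    define q where "q = \<phi> z / z"
    have r: "r > 0" "norm z = r" using elim \<rho> by (auto simp: z_def norm_mult u)
    have "z = rcis r (pi * real k / real D)" by (simp add: z_def u_def rcis_def)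
    moreover have "q = rcis (norm q) (Arg q)" by (simp add: rcis_cmod_Arg)
    moreover have "\<phi> z = z * q" using r by (auto simp: q_def)
    ultimately have \<phi>z: "\<phi> z = rcis (r * norm q) (pi * real k / real D + Arg q)" by (metis rcis_mult)
    have "norm (\<phi> z) = r * norm q" using r by (simp add: q_def norm_divide)
    moreover have "norm z / 2 \<le> norm (\<phi> z)" using size r elim \<rho> by auto
    ultimately have "r * norm q \<ge> \<rho>" using elim r by linarith
    moreover have "pi * (real k - 1) / real D \<le> pi * real k / real D + Arg q" "pi * real k / real D + Arg q \<le> pi * (real k + 1) / real D"
    proof -
      have "\<bar>Arg q\<bar> < pi / real D" using elim by (simp add: q_def z_def dist_norm)
      hence A: "- (pi / real D) \<le> Arg q" "Arg q \<le> pi / real D" by linarith+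
      have "pi * (real k - 1) / real D = pi * real k / real D + - (pi / real D)"
        by (simp add: diff_divide_distrib algebra_simps)
      also have "\<dots> \<le> pi * real k / real D + Arg q" by (intro add_left_mono A)
      finally show "pi * (real k - 1) / real D \<le> pi * real k / real D + Arg q" .
      have "pi * real k / real D + Arg q \<le> pi * real k / real D + pi / real D" by (intro add_left_mono A)
      also have "\<dots> = pi * (real k + 1) / real D" by (simp add: add_divide_distrib algebra_simps)
      finally show "pi * real k / real D + Arg q \<le> pi * (real k + 1) / real D" .
    qed
    ultimately have "\<phi> z \<in> {w. \<exists>r \<theta>. w = rcis r \<theta> \<and> r \<ge> \<rho> \<and>
                pi * (real k - 1) / real D \<le> \<theta> \<and> \<theta> \<le> pi * (real k + 1) / real D}"
      using \<phi>z by blast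
    hence "\<psi> (\<phi> z) \<in> S" unfolding S_def sibuya_sector_def by (rule imageI)
    thus ?case using elim by (simp add: z_def)
  qed
  hence filt: "filterlim (\<lambda>r. of_real r * u) (inf at_infinity (principal S)) at_top"
    using ray by (simp add: filterlim_inf filterlim_principal)
  have "(\<lambda>z. F z - 1) \<in> O[inf at_infinity (principal S)](\<lambda>z. of_real (norm z) powi (2 - int D))"
    using F by (simp add: is_sibuya_F_def S_def)
  then obtain c' where "\<forall>\<^sub>F z in inf at_infinity (principal S). norm (F z - 1) \<le> c' * norm (of_real (norm z) powi (2 - int D) :: complex)"
    by (rule landau_o.bigE)
  from eventually_compose_filterlim[OF this filt]
  have "\<forall>\<^sub>F r in at_top. norm (F (of_real r * u) - 1) \<le> c' * norm (of_real (norm (of_real r * u)) powi (2 - int D) :: complex)" .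
  hence bd: "\<forall>\<^sub>F r in at_top. norm (F (of_real r * u) - 1) \<le> c' * inverse (r ^ (D - 2))"
    using eventually_gt_at_top[of 0]
  proof eventually_elim
    case (elim r)
    have e: "2 - int D = - int (D - 2)" using D by simp
    have n: "norm (of_real r * u) = r" using elim by (simp add: norm_mult u)
    have "norm (of_real r powi (- int (D - 2)) :: complex) = inverse (r ^ (D - 2))"
      unfolding power_int_minus power_int_of_nat norm_inverse norm_power norm_of_real using elim by simp
    thus ?case using elim(1) unfolding n e by simp
  qed
  have "((\<lambda>r::real. c' * inverse (r ^ (D - 2))) \<longlongrightarrow> c' * 0) at_top"
    by (intro tendsto_intros tendsto_inverse_0_at_top filterlim_pow_at_top filterlim_ident) (use D in simp)
  hence "((\<lambda>r. F (of_real r * u) - 1) \<longlongrightarrow> 0) at_top" using Lim_null_comparison[OF bd] by simp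
  hence "((\<lambda>r. F (of_real r * u) - 1 + 1) \<longlongrightarrow> 0 + 1) at_top" by (intro tendsto_intros)
  thus ?thesis by (simp add: u_def)
qed

lemma Re_mult_of_real: "Re (z * of_real x) = Re z * x"
  by simp

text \<open>
  The bilinear concomitant of Lagrange's identity for \<open>L f = V' f' - f'' + f / \<lambda>\<close>, which is
  symmetric with respect to the weight \<open>exp (- V)\<close>.
\<close>

definition concomitant :: "real poly \<Rightarrow> (complex \<Rightarrow> complex) \<Rightarrow> (complex \<Rightarrow> complex) \<Rightarrow> complex \<Rightarrow> complex" where
  "concomitant V f g z = exp (- poly (cpoly V) z) * (f z * deriv g z - deriv f z * g z)"

text \<open>
  \<open>L f = Q\<close> for entire \<open>f\<close>, solved for the second derivative.
\<close>

definition solves_sobolev_ode :: "real poly \<Rightarrow> real \<Rightarrow> complex poly \<Rightarrow> (complex \<Rightarrow> complex) \<Rightarrow> bool" where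
  "solves_sobolev_ode V lam Q f \<longleftrightarrow> f holomorphic_on UNIV \<and>
     (\<forall>z. deriv (deriv f) z = poly (cpoly (pderiv V)) z * deriv f z + f z / of_real lam - poly Q z)"

lemma solves_sobolev_ode_poly:
  "solves_sobolev_ode V lam Q (poly P) \<longleftrightarrow> sobolev_op (cpoly V) (of_real (1 / lam)) P = Q"
proof -
  have d: "deriv (poly P) = poly (pderiv P)" for P :: "complex poly"
    by (rule ext, rule DERIV_imp_deriv, rule poly_DERIV)
  have "sobolev_op (cpoly V) (of_real (1 / lam)) P = Q \<longleftrightarrow> (\<forall>z. poly (sobolev_op (cpoly V) (of_real (1 / lam)) P) z = poly Q z)"
    by (simp add: poly_eq_poly_eq_iff[symmetric] fun_eq_iff)
  also have "\<dots> \<longleftrightarrow> (\<forall>z. poly (pderiv (pderiv P)) z = poly (cpoly (pderiv V)) z * poly (pderiv P) z + poly P z / of_real lam - poly Q z)"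
  proof (rule all_cong1)
    fix z
    show "(poly (sobolev_op (cpoly V) (of_real (1 / lam)) P) z = poly Q z) \<longleftrightarrow>
      (poly (pderiv (pderiv P)) z = poly (cpoly (pderiv V)) z * poly (pderiv P) z + poly P z / of_real lam - poly Q z)"
      by (simp add: sobolev_op_def cpoly_pderiv algebra_simps eq_diff_eq) metis
  qed
  also have "\<dots> \<longleftrightarrow> solves_sobolev_ode V lam Q (poly P)"
    unfolding solves_sobolev_ode_def d by (auto intro!: holomorphic_intros)
  finally show ?thesis ..
qed

lemma solves_sobolev_odeD:
  assumes "solves_sobolev_ode V lam Q f"
  shows "(f has_field_derivative deriv f z) (at z)"
    and "(deriv f has_field_derivative (poly (cpoly (pderiv V)) z * deriv f z + f z / of_real lam - poly Q z)) (at z)"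
proof -
  have hol: "f holomorphic_on UNIV" using assms by (simp add: solves_sobolev_ode_def)
  hence hol': "deriv f holomorphic_on UNIV" by (rule holomorphic_deriv) simp
  show "(f has_field_derivative deriv f z) (at z)" using hol by (rule holomorphic_derivI) auto
  have "(deriv f has_field_derivative deriv (deriv f) z) (at z)" using hol' by (rule holomorphic_derivI) auto
  thus "(deriv f has_field_derivative (poly (cpoly (pderiv V)) z * deriv f z + f z / of_real lam - poly Q z)) (at z)"
    using assms by (simp add: solves_sobolev_ode_def)
qed

text \<open>
  Lagrange's identity. The terms with \<open>V'\<close> and \<open>1 / \<lambda>\<close> cancel by symmetry and only the right-hand
  side of the inhomogeneous equation is left.
\<close>

lemma concomitant_derivative:
  assumes f: "solves_sobolev_ode V lam Q f" and g: "solves_sobolev_ode V lam 0 g"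
  shows "(concomitant V f g has_field_derivative g z * poly Q z * exp (- poly (cpoly V) z)) (at z)"
proof -
  have "((\<lambda>z. exp (- poly (cpoly V) z) * (f z * deriv g z - deriv f z * g z)) has_field_derivative
     (- poly (cpoly (pderiv V)) z * exp (- poly (cpoly V) z)) * (f z * deriv g z - deriv f z * g z) +
     exp (- poly (cpoly V) z) * ((f z * (poly (cpoly (pderiv V)) z * deriv g z + g z / of_real lam - poly 0 z) + deriv f z * deriv g z)
       - (deriv f z * deriv g z + (poly (cpoly (pderiv V)) z * deriv f z + f z / of_real lam - poly Q z) * g z))) (at z)"
    using solves_sobolev_odeD[OF f] solves_sobolev_odeD[OF g]
    by (auto intro!: derivative_eq_intros simp: cpoly_pderiv algebra_simps)
  thus ?thesis unfolding concomitant_def[abs_def] by (simp add: algebra_simps)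
qed

text \<open>
  The ray conditions involve \<open>Y\<^sub>0\<close>, \<open>Y\<^sub>D\<close> and \<open>Y\<^sub>2\<^sub>j\<close>. All these indices are even, so the
  corresponding \<open>F\<^sub>k\<close> solve one and the same equation \<open>L F = 0\<close>.
\<close>

locale sibuya_solutions = sobolev_weight +
  fixes F :: "nat \<Rightarrow> complex \<Rightarrow> complex"
  assumes F_solves: "\<And>k. k < 2 * D \<Longrightarrow> even k \<Longrightarrow> solves_sobolev_ode V lam 0 (F k)"
    and F_limit: "\<And>k. k < 2 * D \<Longrightarrow> even k \<Longrightarrow> ((\<lambda>r. F k (of_real r * cis (pi * real k / real D))) \<longlongrightarrow> 1) at_top"
begin

abbreviation ray_dir :: "nat \<Rightarrow> complex" where "ray_dir k \<equiv> cis (pi * real k / real D)"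

lemma ray_dir_power [simp]: "even k \<Longrightarrow> ray_dir k ^ D = 1"
proof -
  assume "even k"
  then obtain j where j: "k = 2 * j" by blast
  have "ray_dir k ^ D = cis (real D * (pi * real k / real D))" by (rule Complex.DeMoivre)
  also have "real D * (pi * real k / real D) = 2 * pi * real j" using D4 by (simp add: j)
  also have "cis \<dots> = 1" by (rule cis_multiple_2pi) simp
  finally show "ray_dir k ^ D = 1" .
qed

definition ray_moment :: "nat \<Rightarrow> complex poly \<Rightarrow> complex" where
  "ray_moment k Q = ray_integral D k (\<lambda>z. F k z * poly Q z * exp (- poly (cpoly V) z))"

text \<open>
  Lagrange's identity, integrated along a ray on which the weight decays.
\<close>

lemma concomitant_ray_limit:
  assumes f: "solves_sobolev_ode V lam Q f" and k: "k < 2 * D" "even k"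
  shows "((\<lambda>r. concomitant V f (F k) (of_real r * ray_dir k)) \<longlongrightarrow> concomitant V f (F k) 0 + ray_moment k Q) at_top"
proof -
  let ?g = "\<lambda>r::real. F k (of_real r * ray_dir k) * poly Q (of_real r * ray_dir k) * exp (- poly (cpoly V) (of_real r * ray_dir k)) * ray_dir k"
  have F: "F k holomorphic_on UNIV" using F_solves[OF k] by (simp add: solves_sobolev_ode_def)
  have cont: "continuous_on {0..} ?g"
  proof -
    have "(\<lambda>z. F k z * poly Q z * exp (- poly (cpoly V) z) * ray_dir k) holomorphic_on UNIV"
      using F by (intro holomorphic_intros)
    from continuous_on_ray[OF this, of "ray_dir k"] show ?thesis by (rule continuous_on_subset) simp
  qed
  have u: "norm (ray_dir k) = 1" "Re (ray_dir k ^ D) > 0" using k by auto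
  from tendsto_mult_right[OF weight_decay[OF u F_limit[OF k], of Q], where c = "ray_dir k"]
  have "((\<lambda>r. exp r *\<^sub>R ?g r) \<longlongrightarrow> 0) at_top" by simp
  note int = set_integrable_exp_decay[OF cont this]
  have "((\<lambda>r. concomitant V f (F k) (of_real r * ray_dir k)) \<longlongrightarrow> concomitant V f (F k) (of_real 0 * ray_dir k) + (LBINT r:{0..}. ?g r)) at_top"
  proof (rule half_line_FTC[OF _ cont int])
    fix r
    show "((\<lambda>r. concomitant V f (F k) (of_real r * ray_dir k)) has_vector_derivative ?g r) (at r)"
      using ray_has_vector_derivative[OF concomitant_derivative[OF f F_solves[OF k]], where r = r and u = "ray_dir k"] by (simp add: mult_ac)
  qed
  thus ?thesis by (simp add: ray_moment_def ray_integral_def)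
qed

text \<open>
  The asymptotic expansion controls \<open>F\<^sub>k\<close> but not its derivative. The limit \<open>l\<close> of the product
  exists by Lagrange's identity with \<open>f = P\<close>. Up to terms that tend to \<open>0\<close> and the constant factor
  given by the direction, the product is also the derivative of \<open>F\<^sub>k P exp (- V)\<close> along the ray.
  As this function tends to \<open>0\<close>, so does its derivative, and \<open>l = 0\<close>.
\<close>

lemma sibuya_derivative_decay:
  assumes k: "k < 2 * D" "even k"
  shows "((\<lambda>r. deriv (F k) (of_real r * ray_dir k) * poly P (of_real r * ray_dir k) * exp (- poly (cpoly V) (of_real r * ray_dir k))) \<longlongrightarrow> 0) at_top"
proof -
  let ?Q = "sobolev_op (cpoly V) (of_real (1 / lam)) P"
  have f: "solves_sobolev_ode V lam ?Q (poly P)" by (simp add: solves_sobolev_ode_poly)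
  have dP: "deriv (poly P) = poly (pderiv P)"
    by (rule ext, rule DERIV_imp_deriv, rule poly_DERIV)
  define l where "l = concomitant V (poly P) (F k) 0 + ray_moment k ?Q"
  have u: "norm (ray_dir k) = 1" "Re (ray_dir k ^ D) > 0" using k by auto
  note dec = weighted_poly_tendsto_0[OF u F_limit[OF k]]
  have l: "((\<lambda>r. deriv (F k) (of_real r * ray_dir k) * poly P (of_real r * ray_dir k) * exp (- poly (cpoly V) (of_real r * ray_dir k))) \<longlongrightarrow> l) at_top"
    using tendsto_add[OF concomitant_ray_limit[OF f k] dec[of "pderiv P"]]
    by (simp add: concomitant_def dP l_def algebra_simps)
  let ?h' = "\<lambda>r::real. ray_dir k * (deriv (F k) (of_real r * ray_dir k) * poly P (of_real r * ray_dir k) * exp (- poly (cpoly V) (of_real r * ray_dir k))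
      + F k (of_real r * ray_dir k) * poly (pderiv P - cpoly (pderiv V) * P) (of_real r * ray_dir k) * exp (- poly (cpoly V) (of_real r * ray_dir k)))"
  have "ray_dir k * (l + 0) = 0"
  proof (rule limit_of_derivative_eq_0[OF _ dec[of P], where h' = ?h' and a = 0])
    show "(?h' \<longlongrightarrow> ray_dir k * (l + 0)) at_top"
      by (intro tendsto_mult tendsto_add tendsto_const l dec)
    fix r :: real
    have "((\<lambda>z. F k z * poly P z * exp (- poly (cpoly V) z)) has_field_derivative
        (deriv (F k) z * poly P z * exp (- poly (cpoly V) z) + F k z * poly (pderiv P - cpoly (pderiv V) * P) z * exp (- poly (cpoly V) z))) (at z)" for z
      using solves_sobolev_odeD[OF F_solves[OF k]]
      by (auto intro!: derivative_eq_intros simp: cpoly_pderiv algebra_simps)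
    from ray_has_vector_derivative[OF this]
    show "((\<lambda>r. F k (of_real r * ray_dir k) * poly P (of_real r * ray_dir k) * exp (- poly (cpoly V) (of_real r * ray_dir k))) has_vector_derivative ?h' r) (at r)" .
  qed
  hence "l = 0" by simp
  with l show ?thesis by simp
qed

text \<open>
  For polynomial \<open>P\<close> the concomitant tends to \<open>0\<close> along the ray, because both \<open>F\<^sub>k\<close> and its
  derivative are dominated by the weight. Only the boundary term at the origin is left.
\<close>

lemma ray_moment_sobolev_op:
  assumes k: "k < 2 * D" "even k"
  shows "ray_moment k (sobolev_op (cpoly V) (of_real (1 / lam)) P) = - concomitant V (poly P) (F k) 0"
proof -
  let ?Q = "sobolev_op (cpoly V) (of_real (1 / lam)) P"
  have f: "solves_sobolev_ode V lam ?Q (poly P)" by (simp add: solves_sobolev_ode_poly)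
  have dP: "deriv (poly P) = poly (pderiv P)"
    by (rule ext, rule DERIV_imp_deriv, rule poly_DERIV)
  have u: "norm (ray_dir k) = 1" "Re (ray_dir k ^ D) > 0" using k by auto
  have "((\<lambda>r. concomitant V (poly P) (F k) (of_real r * ray_dir k)) \<longlongrightarrow> 0) at_top"
    using tendsto_diff[OF sibuya_derivative_decay[OF k, of P] weighted_poly_tendsto_0[OF u F_limit[OF k], of "pderiv P"]]
    by (simp add: concomitant_def dP algebra_simps)
  from tendsto_unique[OF _ concomitant_ray_limit[OF f k] this]
  show ?thesis by (simp add: eq_neg_iff_add_eq_0 add.commute)
qed

text \<open>
  The Wronskian of two of the \<open>F\<^sub>k\<close> becomes constant only after multiplication by \<open>exp (- V)\<close>. Its
  value at \<open>0\<close> takes the role of that constant.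
\<close>

definition jet_wr :: "nat \<Rightarrow> nat \<Rightarrow> complex" where
  "jet_wr a b = F a 0 * deriv (F b) 0 - deriv (F a) 0 * F b 0"

text \<open>
  On a real half-line \<open>Re (u F' exp (- V) cnj F)\<close> has the derivative
  \<open>exp (- V) (|F'|\<^sup>2 + |F|\<^sup>2 / \<lambda>) \<ge> 0\<close> and tends to \<open>0\<close>; since \<open>F \<rightarrow> 1\<close>, it is not constant, so it
  starts at a negative value.
\<close>

lemma sibuya_log_derivative_sign:
  assumes k: "k < 2 * D" "even k" and real: "ray_dir k = of_real s" and s: "s * s = 1"
  shows "Re (ray_dir k * deriv (F k) 0 * cnj (F k 0)) < 0"
proof -
  let ?E = "\<lambda>z. exp (- poly (cpoly V) z)"
  define N where "N = (\<lambda>r::real. ray_dir k * (deriv (F k) (of_real r * ray_dir k) * ?E (of_real r * ray_dir k)) * cnj (F k (of_real r * ray_dir k)))"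
  define N' where "N' = (\<lambda>r::real. exp (- poly V (r * s)) * ((norm (F k (of_real r * ray_dir k)))\<^sup>2 / lam + (norm (deriv (F k) (of_real r * ray_dir k)))\<^sup>2))"
  note F = solves_sobolev_odeD[OF F_solves[OF k]]
  have E_real: "?E (of_real r * ray_dir k) = of_real (exp (- poly V (r * s)))" for r
    unfolding real of_real_mult[symmetric] cpoly_of_real by (metis exp_of_real of_real_minus)
  have dir_sq: "ray_dir k * cnj (ray_dir k) = 1" "ray_dir k * ray_dir k = 1"
    unfolding real using s by (simp_all flip: of_real_mult)
  have N_deriv: "((\<lambda>r. Re (N r)) has_real_derivative N' r) (at r)" for r
  proof -
    let ?z = "of_real r * ray_dir k"
    have "((\<lambda>z. deriv (F k) z * ?E z) has_field_derivative F k ?z / of_real lam * ?E ?z) (at ?z)"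
      by (auto intro!: derivative_eq_intros F simp: cpoly_pderiv algebra_simps)
    note 1 = ray_has_vector_derivative[OF this]
    note 2 = has_vector_derivative_cnj[OF ray_has_vector_derivative[OF F(1), where r = r and u = "ray_dir k"]]
    have "(N has_vector_derivative (ray_dir k * (deriv (F k) ?z * ?E ?z)) * cnj (ray_dir k * deriv (F k) ?z) +
       (ray_dir k * (ray_dir k * (F k ?z / of_real lam * ?E ?z))) * cnj (F k ?z)) (at r)"
      unfolding N_def by (rule has_vector_derivative_mult[OF has_vector_derivative_mult_right[OF 1] 2])
    also have "(ray_dir k * (deriv (F k) ?z * ?E ?z)) * cnj (ray_dir k * deriv (F k) ?z) +
       (ray_dir k * (ray_dir k * (F k ?z / of_real lam * ?E ?z))) * cnj (F k ?z) =
       (ray_dir k * cnj (ray_dir k)) * ?E ?z * (deriv (F k) ?z * cnj (deriv (F k) ?z)) +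
       (ray_dir k * ray_dir k) * ?E ?z * (F k ?z * cnj (F k ?z)) / of_real lam"
      by (simp add: algebra_simps)
    also have "\<dots> = of_real (N' r)"
      unfolding E_real dir_sq complex_norm_square[symmetric] by (simp add: N'_def algebra_simps)
    finally show ?thesis
      using bounded_linear.has_vector_derivative[OF bounded_linear_Re, of N "of_real (N' r)"] by (simp add: has_real_derivative_iff_has_vector_derivative)
  qed
  have "(N \<longlongrightarrow> ray_dir k * 0 * cnj 1) at_top"
    unfolding N_def using sibuya_derivative_decay[OF k, of 1] by (intro tendsto_intros F_limit[OF k]) simp
  hence N_lim: "((\<lambda>r. Re (N r)) \<longlongrightarrow> 0) at_top" using tendsto_Re by fastforce
  have N'_nonneg: "N' r \<ge> 0" for r unfolding N'_def using lam_pos by auto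
  have mono: "Re (N a) \<le> Re (N b)" if "a \<le> b" for a b
    by (rule DERIV_nonneg_imp_nondecreasing[where f = "\<lambda>r. Re (N r)", OF that]) (use N_deriv N'_nonneg in blast)
  have nonpos: "Re (N a) \<le> 0" for a
    by (rule tendsto_lowerbound[OF N_lim]) (auto intro!: eventually_at_top_linorderI[of a] mono)
  have "\<forall>\<^sub>F r in at_top. F k (of_real r * ray_dir k) \<noteq> 0"
    using tendsto_imp_eventually_ne[OF F_limit[OF k]] by simp
  then obtain R where R: "\<And>r. r \<ge> R \<Longrightarrow> F k (of_real r * ray_dir k) \<noteq> 0" unfolding eventually_at_top_linorder by blast
  define R' where "R' = max R 0"
  have "Re (N R') < Re (N (R' + 1))"
  proof (rule DERIV_pos_imp_increasing[where f = "\<lambda>r. Re (N r)"])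
    fix x assume "R' \<le> x" "x \<le> R' + 1"
    hence "norm (F k (of_real x * ray_dir k)) > 0" using R[of x] by (simp add: R'_def)
    hence "N' x > 0" unfolding N'_def using lam_pos by (intro mult_pos_pos add_pos_nonneg divide_pos_pos) auto
    thus "\<exists>y. ((\<lambda>r. Re (N r)) has_real_derivative y) (at x) \<and> y > 0" using N_deriv by blast
  qed simp
  moreover have "Re (N 0) \<le> Re (N R')" by (rule mono) (simp add: R'_def)
  ultimately have "Re (N 0) < 0" using nonpos[of "R' + 1"] by linarith
  moreover have "N 0 = of_real (exp (- poly V 0)) * (ray_dir k * deriv (F k) 0 * cnj (F k 0))"
    using E_real[of 0] by (simp add: N_def)
  ultimately show ?thesis by (simp only: Re_complex_of_real times_complex.sel(1) Im_complex_of_real mult_zero_left diff_zero) (simp add: mult_less_0_iff)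
qed

text \<open>
  The logarithmic derivatives at \<open>0\<close> have a negative real part for \<open>F\<^sub>0\<close>, which tends to \<open>1\<close> on the
  positive half-line, and a positive one for \<open>F\<^sub>D\<close>, which does so on the negative one. Hence they
  are different.
\<close>

lemma jet_wr_0_D_nonzero: "jet_wr 0 D \<noteq> 0"
proof
  assume "jet_wr 0 D = 0"
  hence eq: "F 0 0 * deriv (F D) 0 = deriv (F 0) 0 * F D 0" by (simp add: jet_wr_def)
  have 0: "Re (deriv (F 0) 0 * cnj (F 0 0)) < 0"
    using sibuya_log_derivative_sign[of 0 1] by simp
  have dirD: "ray_dir D = -1" by simp
  have D: "Re (- deriv (F D) 0 * cnj (F D 0)) < 0"
    using sibuya_log_derivative_sign[of D "-1"] evenD unfolding dirD by simp
  have ne: "F 0 0 \<noteq> 0" "F D 0 \<noteq> 0" using 0 D by auto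
  have "deriv (F D) 0 * cnj (F D 0) * of_real ((norm (F 0 0))\<^sup>2) = deriv (F 0) 0 * cnj (F 0 0) * of_real ((norm (F D 0))\<^sup>2)"
    using eq unfolding complex_norm_square by (simp add: mult_ac)
  from arg_cong[OF this, of Re]
  have "Re (deriv (F D) 0 * cnj (F D 0)) * (norm (F 0 0))\<^sup>2 = Re (deriv (F 0) 0 * cnj (F 0 0)) * (norm (F D 0))\<^sup>2"
    by (simp only: Re_mult_of_real)
  moreover have "Re (deriv (F D) 0 * cnj (F D 0)) * (norm (F 0 0))\<^sup>2 > 0" using D ne by simp
  moreover have "Re (deriv (F 0) 0 * cnj (F 0 0)) * (norm (F D 0))\<^sup>2 < 0" using 0 ne by (simp add: mult_neg_pos)
  ultimately show False by linarith
qed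

end

section \<open>Growth of entire solutions of the inhomogeneous equation\<close>

lemma power_bound_from_1:
  fixes g :: "real \<Rightarrow> complex"
  assumes cont: "continuous_on UNIV g" and le: "\<And>r. r \<ge> R \<Longrightarrow> norm (g r) \<le> C * r ^ N"
  shows "\<exists>C\<ge>0. \<forall>r\<ge>1. norm (g r) \<le> C * r ^ N"
proof -
  have "compact (g ` {1..R})"
    by (intro compact_continuous_image continuous_on_subset[OF cont]) auto
  from compact_imp_bounded[OF this] obtain B where B: "\<And>r. r \<in> {1..R} \<Longrightarrow> norm (g r) \<le> B"
    unfolding bounded_iff by blast
  define C' where "C' = \<bar>C\<bar> + \<bar>B\<bar>"
  have "norm (g r) \<le> C' * r ^ N" if "r \<ge> 1" for r
  proof (cases "r \<ge> R")
    case True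
    have "norm (g r) \<le> C * r ^ N" by (rule le[OF True])
    also have "\<dots> \<le> C' * r ^ N" using that by (intro mult_right_mono) (auto simp: C'_def)
    finally show ?thesis .
  next
    case False
    have "norm (g r) \<le> C' * 1" using B[of r] False that by (auto simp: C'_def)
    also have "\<dots> \<le> C' * r ^ N" using that by (intro mult_left_mono) (auto simp: C'_def)
    finally show ?thesis .
  qed
  thus ?thesis by (intro exI[of _ C']) (auto simp: C'_def)
qed

lemma poly_bound_on_ray:
  fixes p :: "complex poly"
  assumes u: "norm u = 1"
  shows "\<exists>C\<ge>0. \<forall>r\<ge>1. norm (poly p (of_real r * u)) \<le> C * r ^ degree p"
proof -
  obtain C where C: "C \<ge> 0" "\<And>z. norm (poly p z) \<le> C * (1 + norm z) ^ degree p"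
    using norm_poly_le_power[of p] by blast
  have "norm (poly p (of_real r * u)) \<le> (C * 2 ^ degree p) * r ^ degree p" if "r \<ge> 1" for r
  proof -
    have "norm (poly p (of_real r * u)) \<le> C * (1 + r) ^ degree p"
      using C(2)[of "of_real r * u"] u that by (simp add: norm_mult)
    also have "\<dots> \<le> C * (2 * r) ^ degree p" using that C(1) by (intro mult_left_mono power_mono) auto
    finally show ?thesis by (simp add: power_mult_distrib mult.assoc)
  qed
  thus ?thesis using C(1) by (intro exI[of _ "C * 2 ^ degree p"]) auto
qed

lemma le_one_plus_square: "x \<le> 1 + x\<^sup>2" for x :: real
proof -
  have "(x - 1)\<^sup>2 = x\<^sup>2 - 2 * x + 1" by (simp add: power2_eq_square algebra_simps)
  thus ?thesis using zero_le_power2[of "x - 1"] zero_le_power2[of x] by linarith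
qed

context sobolev_weight
begin

lemma V_ray_derivative:
  "((\<lambda>r. Re (poly (cpoly V) (of_real r * u))) has_real_derivative Re (u * poly (cpoly (pderiv V)) (of_real r * u))) (at r)"
  using bounded_linear.has_vector_derivative[OF bounded_linear_Re, OF ray_has_vector_derivative[where f = "poly (cpoly V)", OF poly_DERIV, where r = r and u = u]]
  by (simp add: has_real_derivative_iff_has_vector_derivative cpoly_pderiv)

text \<open>
  Reduction of order: \<open>(f / g)' = - exp V * concomitant f g / g\<^sup>2\<close>. Since the concomitant tends to
  \<open>0\<close>, it is the tail of the integral of \<open>g Q exp (- V)\<close>, hence of the size of \<open>r ^ M exp (- V)\<close>, and
  the two exponentials cancel.
\<close>

lemma ray_bound_of_vanishing_concomitant:
  assumes u: "norm u = 1" "Re (u ^ D) > 0"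
    and f: "solves_sobolev_ode V lam Q f" and g: "solves_sobolev_ode V lam 0 g"
    and g_lim: "((\<lambda>r. g (of_real r * u)) \<longlongrightarrow> 1) at_top"
    and conc: "((\<lambda>r. concomitant V f g (of_real r * u)) \<longlongrightarrow> 0) at_top"
  shows "\<exists>C\<ge>0. \<exists>N. \<forall>r\<ge>1. norm (f (of_real r * u)) \<le> C * r ^ N"
proof -
  define v where "v = (\<lambda>r::real. Re (poly (cpoly V) (of_real r * u)))"
  define v' where "v' = (\<lambda>r::real. Re (u * poly (cpoly (pderiv V)) (of_real r * u)))"
  have v: "(v has_real_derivative v' r) (at r)" for r
    unfolding v_def v'_def by (rule V_ray_derivative)
  define M where "M = degree Q"
  obtain C where C: "C \<ge> 0" "\<And>r. r \<ge> 1 \<Longrightarrow> norm (poly Q (of_real r * u)) \<le> C * r ^ M"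
    unfolding M_def using poly_bound_on_ray[OF u(1), of Q] by blast
  have "\<forall>\<^sub>F r in at_top. dist (g (of_real r * u)) 1 < 1 / 2" by (rule tendstoD[OF g_lim]) simp
  moreover have "\<forall>\<^sub>F r in at_top. v' r \<ge> real M + 1"
    using V_slope_at_top[OF u] unfolding v'_def by (simp add: filterlim_at_top)
  ultimately have "\<forall>\<^sub>F r in at_top. dist (g (of_real r * u)) 1 < 1 / 2 \<and> v' r \<ge> real M + 1"
    by (rule eventually_conj)
  then obtain R0 where R0: "\<And>r. r \<ge> R0 \<Longrightarrow> dist (g (of_real r * u)) 1 < 1 / 2 \<and> v' r \<ge> real M + 1"
    unfolding eventually_at_top_linorder by blast
  define R where "R = max R0 1"
  have R: "v' r \<ge> real M + 1" "r \<ge> 1" if "r \<ge> R" for r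
    using R0[of r] that by (auto simp: R_def)
  have g2: "norm (g (of_real r * u)) \<le> 2" and g12: "norm (g (of_real r * u)) \<ge> 1 / 2" if "r \<ge> R" for r
  proof -
    have d: "norm (g (of_real r * u) - 1) < 1 / 2" using R0[of r] that by (auto simp: R_def dist_norm)
    show "norm (g (of_real r * u)) \<le> 2" using d norm_triangle_ineq2[of "g (of_real r * u)" 1] by simp
    show "norm (g (of_real r * u)) \<ge> 1 / 2"
      using d norm_triangle_ineq2[of 1 "g (of_real r * u)"] by (simp add: norm_minus_commute)
  qed
  define K where "K = 2 * C"
  define G where "G = (\<lambda>r::real. concomitant V f g (of_real r * u))"
  have K: "K \<ge> 0" using C by (simp add: K_def)
  have G_le: "norm (G r) \<le> K * r ^ M * exp (- v r)" if "r \<ge> R" for r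
  proof (rule norm_le_of_vanishing_majorant[where G = G and a = R])
    show "(G has_vector_derivative u * (g (of_real r * u) * poly Q (of_real r * u) * exp (- poly (cpoly V) (of_real r * u)))) (at r)" for r
      unfolding G_def by (rule ray_has_vector_derivative[OF concomitant_derivative[OF f g]])
    show "((\<lambda>r. K * r ^ M * exp (- v r)) has_real_derivative - (K * exp (- v r) * (r ^ M * v' r - real M * r ^ (M - 1)))) (at r)" for r
      by (auto intro!: derivative_eq_intros v simp: algebra_simps)
    show "(G \<longlongrightarrow> 0) at_top" unfolding G_def by (rule conc)
    show "((\<lambda>r. K * r ^ M * exp (- v r)) \<longlongrightarrow> 0) at_top"
    proof (rule Lim_null_comparison)
      show "((\<lambda>r. K * norm (exp r * r ^ M * exp (- v r))) \<longlongrightarrow> 0) at_top"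
        unfolding v_def by (intro tendsto_mult_right_zero tendsto_norm_zero weight_decay_power u)
      show "\<forall>\<^sub>F r in at_top. norm (K * r ^ M * exp (- v r)) \<le> K * norm (exp r * r ^ M * exp (- v r))"
        using eventually_ge_at_top[of 0]
      proof eventually_elim
        case (elim r)
        have "1 * (r ^ M * exp (- v r)) \<le> exp r * (r ^ M * exp (- v r))" using elim by (intro mult_right_mono) auto
        hence "K * (r ^ M * exp (- v r)) \<le> K * (exp r * (r ^ M * exp (- v r)))" using K by (intro mult_left_mono) auto
        thus ?case using elim K by (simp add: abs_mult mult_ac)
      qed
    qed
    fix r assume r: "r \<ge> R"
    have "norm (u * (g (of_real r * u) * poly Q (of_real r * u) * exp (- poly (cpoly V) (of_real r * u))))
       = norm (g (of_real r * u)) * norm (poly Q (of_real r * u)) * exp (- v r)"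
      using u by (simp add: norm_mult v_def)
    also have "\<dots> \<le> 2 * (C * r ^ M) * exp (- v r)"
      using g2[OF r] C R(2)[OF r] by (intro mult_right_mono mult_mono) auto
    also have "\<dots> = K * exp (- v r) * (r ^ M * 1)" by (simp add: K_def)
    also have "\<dots> \<le> K * exp (- v r) * (r ^ M * v' r - real M * r ^ (M - 1))"
    proof (rule mult_left_mono)
      have "real M * r ^ (M - 1) \<le> real M * r ^ M" using R(2)[OF r] by (intro mult_left_mono power_increasing) auto
      moreover have "r ^ M * (real M + 1) \<le> r ^ M * v' r" using R[OF r] by (intro mult_left_mono) auto
      ultimately show "r ^ M * 1 \<le> r ^ M * v' r - real M * r ^ (M - 1)" by (simp add: algebra_simps)
    qed (use K in auto)
    finally show "norm (u * (g (of_real r * u) * poly Q (of_real r * u) * exp (- poly (cpoly V) (of_real r * u)))) \<le>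
      K * exp (- v r) * (r ^ M * v' r - real M * r ^ (M - 1))" .
  qed (rule that)
  define q where "q = (\<lambda>r::real. f (of_real r * u) / g (of_real r * u))"
  define q' where "q' = (\<lambda>r::real. u * ((deriv f (of_real r * u) * g (of_real r * u) - f (of_real r * u) * deriv g (of_real r * u)) / (g (of_real r * u) * g (of_real r * u))))"
  have q: "(q has_vector_derivative q' r) (at r)" if "r \<ge> R" for r
  proof -
    have "g (of_real r * u) \<noteq> 0" using g12[OF that] by auto
    thus ?thesis unfolding q_def q'_def
      by (intro ray_has_vector_derivative[where f = "\<lambda>z. f z / g z"] DERIV_divide solves_sobolev_odeD(1)[OF f] solves_sobolev_odeD(1)[OF g])
  qed
  have q'_le: "norm (q' r) \<le> 4 * K * r ^ M" if r: "r \<ge> R" for r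
  proof -
    have "deriv f z * g z - f z * deriv g z = - (exp (poly (cpoly V) z) * concomitant V f g z)" for z
      by (simp add: concomitant_def exp_minus_inverse flip: mult.assoc)
    hence "norm (q' r) = exp (v r) * norm (G r) / (norm (g (of_real r * u)) * norm (g (of_real r * u)))"
      using u by (simp add: q'_def norm_mult norm_divide v_def G_def)
    also have "\<dots> \<le> exp (v r) * (K * r ^ M * exp (- v r)) / ((1 / 2) * (1 / 2))"
      using g12[OF r] G_le[OF r] K R(2)[OF r] by (intro frac_le mult_mono) auto
    also have "\<dots> = 4 * K * r ^ M" by (simp add: exp_minus)
    finally show ?thesis .
  qed
  define B where "B = norm (q R)"
  have f_le: "norm (f (of_real r * u)) \<le> 2 * (B + 4 * K) * r ^ (M + 1)" if r: "r \<ge> R" for r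
  proof -
    have "norm (q r - q R) \<le> 4 * K * r ^ (M + 1) - 4 * K * R ^ (M + 1)"
    proof (cases "r = R")
      case False
      show ?thesis
      proof (rule differentiable_bound_general[of R r])
        show "R < r" using False r by simp
        show "continuous_on {R..r} q"
          using q by (meson atLeastAtMost_iff continuous_at_imp_continuous_on has_vector_derivative_continuous)
        show "continuous_on {R..r} (\<lambda>r. 4 * K * r ^ (M + 1))" by (intro continuous_intros)
        fix x assume x: "R < x" "x < r"
        show "(q has_vector_derivative q' x) (at x)" using q x by simp
        show "((\<lambda>r. 4 * K * r ^ (M + 1)) has_vector_derivative 4 * K * (real (M + 1) * x ^ M)) (at x)"
          using DERIV_cmult[OF DERIV_pow[of "M + 1" x], of "4 * K"]
          by (simp add: has_real_derivative_iff_has_vector_derivative)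
        have "norm (q' x) \<le> 4 * K * (1 * x ^ M)" using q'_le[of x] x by simp
        also have "\<dots> \<le> 4 * K * (real (M + 1) * x ^ M)"
          using K R(2)[of x] x by (intro mult_left_mono mult_right_mono) auto
        finally show "norm (q' x) \<le> 4 * K * (real (M + 1) * x ^ M)" .
      qed
    qed simp
    hence "norm (q r) \<le> B + 4 * K * r ^ (M + 1) - 4 * K * R ^ (M + 1)"
      using norm_triangle_ineq2[of "q r" "q R"] by (simp add: B_def)
    also have "\<dots> \<le> B * 1 + 4 * K * r ^ (M + 1)" using K R(2)[of R] by simp
    also have "\<dots> \<le> B * r ^ (M + 1) + 4 * K * r ^ (M + 1)"
      using R(2)[OF r] by (intro add_right_mono mult_left_mono one_le_power) (auto simp: B_def)
    finally have q_le: "norm (q r) \<le> (B + 4 * K) * r ^ (M + 1)" by (simp only: distrib_right)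
    have "g (of_real r * u) \<noteq> 0" using g12[OF r] by auto
    hence "norm (f (of_real r * u)) = norm (g (of_real r * u)) * norm (q r)" by (simp add: q_def norm_divide)
    also have "\<dots> \<le> 2 * ((B + 4 * K) * r ^ (M + 1))" using g2[OF r] q_le by (intro mult_mono) auto
    finally show ?thesis by (simp only: mult.assoc)
  qed
  have "f holomorphic_on UNIV" using f by (simp add: solves_sobolev_ode_def)
  from power_bound_from_1[OF continuous_on_ray[OF this, of u] f_le] show ?thesis by blast
qed

text \<open>
  The sign of the slope of the potential along the ray decides whether the term with
  \<open>|f'|\<^sup>2\<close> damps the energy \<open>|f|\<^sup>2 + |f'|\<^sup>2\<close> or makes it grow.
\<close>

lemma energy_derivative:
  assumes u: "norm u = 1" and f: "solves_sobolev_ode V lam Q f"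
  shows "\<exists>E'. ((\<lambda>r. (norm (f (of_real r * u)))\<^sup>2 + (norm (deriv f (of_real r * u)))\<^sup>2) has_real_derivative E') (at r) \<and>
     E' \<le> 2 * Re (u * poly (cpoly (pderiv V)) (of_real r * u)) * (norm (deriv f (of_real r * u)))\<^sup>2
      + 2 * (1 + 1 / lam) * (norm (f (of_real r * u)) * norm (deriv f (of_real r * u)))
      + 2 * (norm (poly Q (of_real r * u)) * norm (deriv f (of_real r * u)))"
proof -
  let ?z = "of_real r * u"
  let ?W = "poly (cpoly (pderiv V)) ?z"
  define a where "a = f ?z"
  define b where "b = deriv f ?z"
  define c where "c = poly Q ?z"
  note d1 = ray_has_vector_derivative[OF solves_sobolev_odeD(1)[OF f], where r = r and u = u]
  note d2 = ray_has_vector_derivative[OF solves_sobolev_odeD(2)[OF f], where r = r and u = u]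
  note d = bounded_bilinear.has_vector_derivative[OF bounded_bilinear_inner]
  have "((\<lambda>r. (norm (f (of_real r * u)))\<^sup>2 + (norm (deriv f (of_real r * u)))\<^sup>2) has_real_derivative
     (a \<bullet> (u * b) + (u * b) \<bullet> a) + (b \<bullet> (u * (?W * b + a / of_real lam - c)) + (u * (?W * b + a / of_real lam - c)) \<bullet> b)) (at r)"
    unfolding power2_norm_eq_inner has_real_derivative_iff_has_vector_derivative a_def b_def c_def
    by (intro has_vector_derivative_add d d1 d2)
  moreover have "(a \<bullet> (u * b) + (u * b) \<bullet> a) + (b \<bullet> (u * (?W * b + a / of_real lam - c)) + (u * (?W * b + a / of_real lam - c)) \<bullet> b)
     \<le> 2 * Re (u * ?W) * (norm b)\<^sup>2 + 2 * (1 + 1 / lam) * (norm a * norm b) + 2 * (norm c * norm b)"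
  proof -
    have 1: "a \<bullet> (u * b) \<le> norm a * norm b" using norm_cauchy_schwarz[of a "u * b"] u by (simp add: norm_mult)
    have 2: "b \<bullet> (u * a / of_real lam) \<le> norm a * norm b / lam"
      using norm_cauchy_schwarz[of b "u * a / of_real lam"] u lam_pos by (simp add: norm_mult norm_divide mult_ac)
    have 3: "- (b \<bullet> (u * c)) \<le> norm c * norm b"
      using norm_cauchy_schwarz[of b "- (u * c)"] u by (simp add: norm_mult mult_ac)
    have "b \<bullet> ((u * ?W) * b) = Re (u * ?W) * (norm b)\<^sup>2"
      unfolding cmod_power2 inner_complex_def by (simp add: algebra_simps power2_eq_square)
    hence "b \<bullet> (u * (?W * b + a / of_real lam - c)) = Re (u * ?W) * (norm b)\<^sup>2 + b \<bullet> (u * a / of_real lam) - b \<bullet> (u * c)"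
      by (simp add: algebra_simps inner_add_right inner_diff_right)
    moreover have "(u * (?W * b + a / of_real lam - c)) \<bullet> b = b \<bullet> (u * (?W * b + a / of_real lam - c))"
      "(u * b) \<bullet> a = a \<bullet> (u * b)" by (rule inner_commute)+
    moreover have "2 * (1 + 1 / lam) * (norm a * norm b) = 2 * (norm a * norm b) + 2 * (norm a * norm b / lam)"
      by (simp add: algebra_simps)
    ultimately show ?thesis using 1 2 3 unfolding mult.assoc by linarith
  qed
  ultimately show ?thesis unfolding a_def b_def c_def by blast
qed

text \<open>
  Where the potential falls along the ray, the damping term \<open>- 2 r |f'|\<^sup>2\<close> absorbs the mixed terms at
  the cost of \<open>O(1 / r)\<close> times the energy and a polynomial. Gronwall's inequality with
  \<open>k r = K ln r\<close> then yields a power of \<open>r\<close>.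
\<close>

lemma ray_bound_of_falling_weight:
  assumes u: "norm u = 1" "Re (u ^ D) < 0" and f: "solves_sobolev_ode V lam Q f"
  shows "\<exists>C\<ge>0. \<exists>N. \<forall>r\<ge>1. norm (f (of_real r * u)) \<le> C * r ^ N"
proof -
  define a where "a = (\<lambda>r::real. norm (f (of_real r * u)))"
  define b where "b = (\<lambda>r::real. norm (deriv f (of_real r * u)))"
  define c where "c = (\<lambda>r::real. norm (poly Q (of_real r * u)))"
  define L where "L = 1 + 1 / lam"
  define M where "M = 2 * degree Q"
  obtain C where C: "C \<ge> 0" "\<And>r. r \<ge> 1 \<Longrightarrow> c r \<le> C * r ^ degree Q"
    using poly_bound_on_ray[OF u(1), of Q] unfolding c_def by blast
  define K where "K = L\<^sup>2 + C\<^sup>2 + real M"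
  obtain R0 where R0: "\<And>r. r \<ge> R0 \<Longrightarrow> Re (u * poly (cpoly (pderiv V)) (of_real r * u)) \<le> - r"
    using V_slope_le[OF u] unfolding eventually_at_top_linorder by blast
  define R where "R = max R0 1"
  have R: "R \<ge> 1" by (simp add: R_def)
  have "\<forall>r. \<exists>E'. ((\<lambda>r. (a r)\<^sup>2 + (b r)\<^sup>2) has_real_derivative E') (at r) \<and>
       E' \<le> 2 * Re (u * poly (cpoly (pderiv V)) (of_real r * u)) * (b r)\<^sup>2 + 2 * L * (a r * b r) + 2 * (c r * b r)"
    unfolding a_def b_def c_def L_def by (intro allI energy_derivative[OF u(1) f])
  from choice[OF this] obtain E' where E': "\<And>r. ((\<lambda>r. (a r)\<^sup>2 + (b r)\<^sup>2) has_real_derivative E' r) (at r)"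
     "\<And>r. E' r \<le> 2 * Re (u * poly (cpoly (pderiv V)) (of_real r * u)) * (b r)\<^sup>2 + 2 * L * (a r * b r) + 2 * (c r * b r)" by blast
  define Z where "Z = (\<lambda>r. ((a r)\<^sup>2 + (b r)\<^sup>2) + r ^ M)"
  have Z_le: "Z r \<le> Z R * exp (K * ln r - K * ln R)" if "r \<ge> R" for r
  proof (rule gronwall_exp[where Z' = "\<lambda>r. E' r + real M * r ^ (M - 1)" and k = "\<lambda>r. K * ln r" and k' = "\<lambda>r. K / r", OF _ _ _ that])
    fix r assume r: "r \<ge> R"
    hence r1: "r \<ge> 1" using R by simp
    show "(Z has_real_derivative E' r + real M * r ^ (M - 1)) (at r)"
      unfolding Z_def by (intro DERIV_add E'(1)) (auto intro!: derivative_eq_intros)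
    show "((\<lambda>r. K * ln r) has_real_derivative K / r) (at r)"
      using r1 by (auto intro!: derivative_eq_intros)
    have "Re (u * poly (cpoly (pderiv V)) (of_real r * u)) \<le> - r" using r by (intro R0) (simp add: R_def)
    hence slope: "2 * Re (u * poly (cpoly (pderiv V)) (of_real r * u)) * (b r)\<^sup>2 \<le> 2 * (- r) * (b r)\<^sup>2"
      by (intro mult_right_mono) auto
    have young: "2 * (s * b r) \<le> r * (b r)\<^sup>2 + s\<^sup>2 / r" for s
    proof -
      have "0 \<le> (r * b r - s)\<^sup>2 / r" using r1 by simp
      also have "\<dots> = r * (b r)\<^sup>2 - 2 * (s * b r) + s\<^sup>2 / r" using r1 by (simp add: power2_eq_square field_simps)
      finally show ?thesis by simp
    qed
    have "(c r)\<^sup>2 \<le> (C * r ^ degree Q)\<^sup>2" using C(2)[OF r1] by (intro power_mono) (auto simp: c_def)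
    also have "\<dots> = C\<^sup>2 * r ^ M" by (simp add: M_def power_mult_distrib power_mult[symmetric] mult.commute)
    finally have c2: "(c r)\<^sup>2 / r \<le> C\<^sup>2 * r ^ M / r" using r1 by (intro divide_right_mono) auto
    have "E' r \<le> (L * a r)\<^sup>2 / r + (c r)\<^sup>2 / r"
      using E'(2)[of r] slope young[of "L * a r"] young[of "c r"] by (simp add: mult.assoc)
    also have "\<dots> \<le> (L\<^sup>2 * (a r)\<^sup>2 + C\<^sup>2 * r ^ M) / r" using c2 by (simp add: power_mult_distrib add_divide_distrib)
    finally have 1: "E' r \<le> (L\<^sup>2 * (a r)\<^sup>2 + C\<^sup>2 * r ^ M) / r" .
    have "real M * r ^ (M - 1) = real M * r ^ M / r" using r1 by (cases M) auto
    hence "E' r + real M * r ^ (M - 1) \<le> (L\<^sup>2 * (a r)\<^sup>2 + C\<^sup>2 * r ^ M) / r + real M * r ^ M / r" using 1 by simp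
    also have "\<dots> = (L\<^sup>2 * (a r)\<^sup>2 + C\<^sup>2 * r ^ M + real M * r ^ M) / r" by (simp add: add_divide_distrib)
    also have "\<dots> \<le> (K * Z r) / r"
    proof (rule divide_right_mono)
      have "L\<^sup>2 * (a r)\<^sup>2 \<le> K * (a r)\<^sup>2" by (intro mult_right_mono) (auto simp: K_def)
      moreover have "C\<^sup>2 * r ^ M + real M * r ^ M \<le> K * r ^ M"
        unfolding distrib_right[symmetric] using r1 by (intro mult_right_mono) (auto simp: K_def)
      moreover have "0 \<le> K * (b r)\<^sup>2" by (auto simp: K_def)
      ultimately show "L\<^sup>2 * (a r)\<^sup>2 + C\<^sup>2 * r ^ M + real M * r ^ M \<le> K * Z r" by (simp add: Z_def distrib_left)
    qed (use r1 in simp)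
    finally show "E' r + real M * r ^ (M - 1) \<le> K / r * Z r" by simp
  qed
  \<comment> \<open>Gronwall gives the real power \<open>r powr K\<close>; an integer exponent is enough\<close>
  obtain N where N: "real N \<ge> K" using real_arch_simple by blast
  have "K \<ge> 0" by (simp add: K_def)
  have "norm (f (of_real r * u)) \<le> (1 + Z R) * r ^ N" if r: "r \<ge> R" for r
  proof -
    have r1: "r \<ge> 1" using r R by simp
    have ZR: "Z R \<ge> 0" using R by (simp add: Z_def)
    have "(a r)\<^sup>2 \<le> Z r" using r1 by (simp add: Z_def)
    also have "\<dots> \<le> Z R * exp (K * ln r - K * ln R)" by (rule Z_le[OF r])
    also have "\<dots> \<le> Z R * exp (real N * ln r)"
    proof -
      have "K * ln r \<le> real N * ln r" using N r1 by (intro mult_right_mono) auto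
      moreover have "0 \<le> K * ln R" using R \<open>K \<ge> 0\<close> by simp
      ultimately show ?thesis using ZR by (intro mult_left_mono) auto
    qed
    also have "exp (real N * ln r) = r ^ N" using r1 by (simp add: exp_of_nat_mult)
    finally have 1: "(a r)\<^sup>2 \<le> Z R * r ^ N" .
    have "a r \<le> 1 + (a r)\<^sup>2" by (rule le_one_plus_square)
    also have "\<dots> \<le> r ^ N + Z R * r ^ N" using 1 r1 by (intro add_mono) auto
    finally show ?thesis by (simp add: a_def distrib_right)
  qed
  moreover have "f holomorphic_on UNIV" using f by (simp add: solves_sobolev_ode_def)
  ultimately show ?thesis using power_bound_from_1[OF continuous_on_ray[of f u]] by blast
qed

text \<open>
  The energy satisfies \<open>E' \<le> C (1 + r) ^ (D - 1) E\<close> up to polynomial terms, with a constant that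
  does not depend on the direction. Adding a power of \<open>1 + r\<close> to the energy absorbs these terms, and
  Gronwall's inequality applies along all rays at once.
\<close>

lemma solution_growth:
  assumes f: "solves_sobolev_ode V lam Q f"
  shows "\<exists>C. \<forall>z. norm (f z) \<le> C * exp (C * norm z powr real D)"
proof -
  obtain C1 where C1: "C1 \<ge> 0" "\<And>z. norm (poly (cpoly (pderiv V)) z) \<le> C1 * (1 + norm z) ^ (D - 1)"
    using norm_poly_le_power[of "cpoly (pderiv V)"] by (auto simp: degree_map_poly degree_pderiv degV)
  obtain C2 where C2: "C2 \<ge> 0" "\<And>z. norm (poly Q z) \<le> C2 * (1 + norm z) ^ degree Q"
    using norm_poly_le_power[of Q] by blast
  define L where "L = 1 + 1 / lam"
  define M where "M = 2 * degree Q"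
  define K where "K = 2 * C1 + L + 1 + C2\<^sup>2 + real M"
  define Z0 where "Z0 = (norm (f 0))\<^sup>2 + (norm (deriv f 0))\<^sup>2 + 1"
  have L: "L \<ge> 0" using lam_pos by (simp add: L_def)
  have K: "K \<ge> 0" unfolding K_def using C1(1) L by (intro add_nonneg_nonneg) auto
  have ray: "norm (f (of_real R * u)) \<le> Z0 * exp (K * (1 + R) ^ D)" if u: "norm u = 1" and R: "R \<ge> 0" for u R
  proof -
    define a where "a = (\<lambda>r::real. norm (f (of_real r * u)))"
    define b where "b = (\<lambda>r::real. norm (deriv f (of_real r * u)))"
    define c where "c = (\<lambda>r::real. norm (poly Q (of_real r * u)))"
    have "\<forall>r. \<exists>E'. ((\<lambda>r. (a r)\<^sup>2 + (b r)\<^sup>2) has_real_derivative E') (at r) \<and>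
       E' \<le> 2 * Re (u * poly (cpoly (pderiv V)) (of_real r * u)) * (b r)\<^sup>2 + 2 * L * (a r * b r) + 2 * (c r * b r)"
      unfolding a_def b_def c_def L_def by (intro allI energy_derivative[OF u f])
    from choice[OF this] obtain E' where E': "\<And>r. ((\<lambda>r. (a r)\<^sup>2 + (b r)\<^sup>2) has_real_derivative E' r) (at r)"
       "\<And>r. E' r \<le> 2 * Re (u * poly (cpoly (pderiv V)) (of_real r * u)) * (b r)\<^sup>2 + 2 * L * (a r * b r) + 2 * (c r * b r)" by blast
    define Z where "Z = (\<lambda>r. ((a r)\<^sup>2 + (b r)\<^sup>2) + (1 + r) ^ M)"
    have "Z R \<le> Z 0 * exp (K * (1 + R) ^ D - K * (1 + 0) ^ D)"
    proof (rule gronwall_exp[where Z' = "\<lambda>r. E' r + real M * (1 + r) ^ (M - 1)" and k' = "\<lambda>r. K * (real D * (1 + r) ^ (D - 1))", OF _ _ _ R])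
      fix r :: real assume r: "r \<ge> 0"
      show "(Z has_real_derivative E' r + real M * (1 + r) ^ (M - 1)) (at r)"
        unfolding Z_def by (intro DERIV_add E'(1)) (auto intro!: derivative_eq_intros)
      show "((\<lambda>r. K * (1 + r) ^ D) has_real_derivative K * (real D * (1 + r) ^ (D - 1))) (at r)"
        by (auto intro!: derivative_eq_intros)
      define s where "s = (1 + r) ^ (D - 1)"
      have s: "s \<ge> 1" using r by (simp add: s_def)
      have "Re (u * poly (cpoly (pderiv V)) (of_real r * u)) \<le> norm (u * poly (cpoly (pderiv V)) (of_real r * u))"
        by (rule complex_Re_le_cmod)
      also have "\<dots> \<le> C1 * s" using C1(2)[of "of_real r * u"] u r by (simp add: norm_mult s_def)
      finally have slope: "2 * Re (u * poly (cpoly (pderiv V)) (of_real r * u)) * (b r)\<^sup>2 \<le> 2 * (C1 * s) * (b r)\<^sup>2"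
        by (intro mult_right_mono) auto
      have young: "2 * (x * y) \<le> x\<^sup>2 + y\<^sup>2" for x y :: real
        using zero_le_power2[of "x - y"] by (simp add: power2_eq_square algebra_simps)
      have "c r \<le> C2 * (1 + r) ^ degree Q" using C2(2)[of "of_real r * u"] u r by (simp add: norm_mult c_def)
      hence "(c r)\<^sup>2 \<le> (C2 * (1 + r) ^ degree Q)\<^sup>2" by (intro power_mono) (auto simp: c_def)
      also have "\<dots> = C2\<^sup>2 * (1 + r) ^ M" by (simp add: M_def power_mult_distrib power_mult[symmetric] mult.commute)
      finally have c2: "(c r)\<^sup>2 \<le> C2\<^sup>2 * (1 + r) ^ M" .
      have "L * (2 * (a r * b r)) \<le> L * ((a r)\<^sup>2 + (b r)\<^sup>2)" using L by (intro mult_left_mono young)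
      hence 1: "E' r \<le> 2 * (C1 * s) * (b r)\<^sup>2 + L * ((a r)\<^sup>2 + (b r)\<^sup>2) + (C2\<^sup>2 * (1 + r) ^ M + (b r)\<^sup>2)"
        using E'(2)[of r] slope c2 young[of "c r" "b r"] by linarith
      have M_le: "real M * (1 + r) ^ (M - 1) \<le> real M * (1 + r) ^ M"
        using r by (intro mult_left_mono power_increasing) auto
      have "E' r + real M * (1 + r) ^ (M - 1) \<le> (2 * C1 * s) * (b r)\<^sup>2 + (L * ((a r)\<^sup>2 + (b r)\<^sup>2)) + (C2\<^sup>2 * (1 + r) ^ M + (b r)\<^sup>2) + real M * (1 + r) ^ M"
        using 1 M_le by simp
      also have "\<dots> \<le> (2 * C1 * s) * Z r + L * s * Z r + (C2\<^sup>2 * s * Z r + s * Z r) + real M * s * Z r"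
      proof -
        have p: "(1 + r) ^ M \<ge> 0" using r by simp
        have Zb: "(b r)\<^sup>2 \<le> Z r" "(a r)\<^sup>2 + (b r)\<^sup>2 \<le> Z r" "(1 + r) ^ M \<le> Z r" "Z r \<ge> 0" using p by (auto simp: Z_def)
        have sZ: "x \<le> s * Z r" if "x \<le> Z r" for x using that mult_right_mono[OF s Zb(4)] by simp
        show ?thesis
          unfolding mult.assoc[of _ s]
          using C1(1) L s by (intro add_mono mult_left_mono sZ Zb) (auto simp: mult.assoc intro!: mult_left_mono Zb sZ)
      qed
      also have "\<dots> = K * s * Z r" by (simp add: K_def algebra_simps)
      also have "\<dots> \<le> K * (real D * s) * Z r"
      proof -
        have "1 * s \<le> real D * s" using s D4 by (intro mult_right_mono) auto
        moreover note K
        moreover have "Z r \<ge> 0" using r by (simp add: Z_def)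
        ultimately show ?thesis by (intro mult_right_mono mult_left_mono) auto
      qed
      finally show "E' r + real M * (1 + r) ^ (M - 1) \<le> K * (real D * (1 + r) ^ (D - 1)) * Z r" by (simp add: s_def)
    qed
    also have "Z 0 = Z0" by (simp add: Z_def Z0_def a_def b_def)
    also have "Z0 * exp (K * (1 + R) ^ D - K * (1 + 0) ^ D) \<le> Z0 * exp (K * (1 + R) ^ D)"
      using K by (intro mult_left_mono) (auto simp: Z0_def)
    finally have 1: "Z R \<le> Z0 * exp (K * (1 + R) ^ D)" .
    have "a R \<le> 1 + (a R)\<^sup>2" by (rule le_one_plus_square)
    also have "\<dots> \<le> Z R" using R one_le_power[of "1 + R" M] zero_le_power2[of "b R"] unfolding Z_def by linarith
    finally show ?thesis using 1 by (simp add: a_def)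
  qed
  define K' where "K' = K * 2 ^ D"
  have Z0: "Z0 \<ge> 0" by (simp add: Z0_def)
  \<comment> \<open>one constant that dominates both the factor and the exponent\<close>
  define C where "C = Z0 * exp K' + K'"
  have C: "C \<ge> K'" "C \<ge> Z0 * exp K'" "K' \<ge> 0" using K Z0 by (auto simp: C_def K'_def)
  have "norm (f z) \<le> C * exp (C * norm z powr real D)" for z
  proof -
    obtain u where u: "norm u = 1" "z = of_real (norm z) * u"
    proof (cases "z = 0")
      case True
      thus ?thesis using that[of 1] by simp
    next
      case False
      thus ?thesis using that[of "z / of_real (norm z)"] by (simp add: norm_divide)
    qed
    have pow: "norm z powr real D = norm z ^ D" by (cases "z = 0") (auto simp: powr_realpow)
    have "norm (f z) \<le> Z0 * exp (K * (1 + norm z) ^ D)" using ray[OF u(1), of "norm z"] u(2) by simp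
    also have "\<dots> \<le> Z0 * exp (K' + K' * norm z ^ D)"
    proof -
      have "(1 + norm z) ^ D \<le> 2 ^ D * (1 + norm z ^ D)"
      proof (cases "norm z \<le> 1")
        case True
        have "(1 + norm z) ^ D \<le> 2 ^ D" using True by (intro power_mono) auto
        also have "2 ^ D * 1 \<le> 2 ^ D * (1 + norm z ^ D)" by (intro mult_left_mono) auto
        finally show ?thesis by simp
      next
        case False
        have "(1 + norm z) ^ D \<le> (2 * norm z) ^ D" using False by (intro power_mono) auto
        also have "\<dots> \<le> 2 ^ D * (1 + norm z ^ D)" by (simp add: power_mult_distrib)
        finally show ?thesis .
      qed
      from mult_left_mono[OF this K] have "K * (1 + norm z) ^ D \<le> K' + K' * norm z ^ D"
        by (simp add: K'_def algebra_simps)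
      thus ?thesis using Z0 by (intro mult_left_mono) auto
    qed
    also have "\<dots> = (Z0 * exp K') * exp (K' * norm z ^ D)" by (simp add: exp_add)
    also have "\<dots> \<le> C * exp (C * norm z ^ D)"
      using C Z0 by (intro mult_mono iffD2[OF exp_le_cancel_iff] mult_right_mono) auto
    finally show ?thesis by (simp add: pow)
  qed
  thus ?thesis by blast
qed

end

section \<open>Entire solutions that are polynomials\<close>

lemma entire_power_bounded_imp_poly:
  assumes f: "f holomorphic_on UNIV" and le: "\<And>z. norm z \<ge> 1 \<Longrightarrow> norm (f z) \<le> C * norm z ^ N"
  shows "\<exists>p. f = poly p"
proof -
  define p where "p = (\<Sum>k\<le>N. monom ((deriv ^^ k) f 0 / fact k) k)"
  have "f z = poly p z" for z
    using Liouville_polynomial[OF f le] by (simp add: p_def poly_sum poly_monom)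
  thus ?thesis by blast
qed

lemma cos_third_of_turn_neg:
  assumes "\<not> 3 dvd m"
  shows "cos (2 * pi * real m / 3) < 0"
proof -
  define q where "q = m div 3"
  have "m = 3 * q + 1 \<or> m = 3 * q + 2" using assms unfolding q_def by presburger
  thus ?thesis
  proof
    assume m: "m = 3 * q + 1"
    have "2 * pi * real m / 3 = 2 * pi / 3 + 2 * real q * pi" by (simp add: m field_simps)
    hence "cos (2 * pi * real m / 3) = cos (2 * pi / 3)"
      by (simp only: cos_add cos_2npi sin_2npi mult_1_right mult_zero_right diff_zero)
    also have "\<dots> = - 1 / 2" by (rule cos_120)
    finally show ?thesis by simp
  next
    assume m: "m = 3 * q + 2"
    have "2 * pi * real m / 3 = 2 * real (q + 1) * pi - 2 * pi / 3" by (simp add: m field_simps)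
    hence "cos (2 * pi * real m / 3) = cos (2 * pi / 3)"
      by (simp only: cos_diff cos_2npi sin_2npi mult_1_left mult_zero_left add_0_right)
    also have "\<dots> = - 1 / 2" by (rule cos_120)
    finally show ?thesis by simp
  qed
qed

context sibuya_solutions
begin

text \<open>
  Variation of constants with the basis \<open>F\<^sub>0\<close>, \<open>F\<^sub>D\<close>. The antiderivatives \<open>A\<close> and \<open>B\<close> are normalised
  so that they vanish at the far ends of the rays \<open>0\<close> and \<open>D\<close>; they are the concomitants of \<open>f\<close> with
  \<open>F\<^sub>0\<close> and \<open>F\<^sub>D\<close>. The left-hand side of the second claim is, up to the factor \<open>jet_wr 0 D\<close>, the
  limit of the concomitant with \<open>F\<^sub>k\<close> at infinity, and its right-hand side is the ray condition.
\<close>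

lemma entire_solution_exists:
  "\<exists>f. solves_sobolev_ode V lam Q f \<and>
    (\<forall>k. jet_wr 0 D * (concomitant V f (F k) 0 + ray_moment k Q) =
          jet_wr 0 D * ray_moment k Q + jet_wr D k * ray_moment 0 Q + jet_wr k 0 * ray_moment D Q)"
proof -
  let ?e = "\<lambda>z. exp (- poly (cpoly V) z)"
  note F0 = F_solves[of 0, simplified] and FD = F_solves[of D, OF _ evenD, simplified]
  have hol: "F 0 holomorphic_on UNIV" "F D holomorphic_on UNIV"
    using F0 FD by (auto simp: solves_sobolev_ode_def)
  define W where "W = concomitant V (F 0) (F D) 0"
  have W: "concomitant V (F 0) (F D) z = W" for z
  proof -
    have "\<exists>c. \<forall>z\<in>UNIV. concomitant V (F 0) (F D) z = c"
      by (rule has_field_derivative_zero_constant) (use concomitant_derivative[OF F0 FD] in auto)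
    thus ?thesis unfolding W_def by auto
  qed
  have W_wr: "W = ?e 0 * jet_wr 0 D" by (simp add: W_def concomitant_def jet_wr_def)
  hence W0: "W \<noteq> 0" using jet_wr_0_D_nonzero by simp
  have prim: "\<exists>A. A 0 = c \<and> (\<forall>z. (A has_field_derivative g z * poly Q z * ?e z) (at z))"
    if "g holomorphic_on UNIV" for g c
  proof -
    have "(\<lambda>z. g z * poly Q z * ?e z) holomorphic_on UNIV" using that by (intro holomorphic_intros)
    then obtain A where A: "\<And>z. z \<in> UNIV \<Longrightarrow> (A has_field_derivative g z * poly Q z * ?e z) (at z within UNIV)"
      using holomorphic_convex_primitive'[of UNIV "\<lambda>z. g z * poly Q z * ?e z"] by auto
    have "((\<lambda>z. A z - A 0 + c) has_field_derivative g z * poly Q z * ?e z) (at z)" for z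
      using A by (auto intro!: derivative_eq_intros)
    thus ?thesis by (intro exI[of _ "\<lambda>z. A z - A 0 + c"]) auto
  qed
  obtain A where A: "A 0 = - ray_moment 0 Q" "\<And>z. (A has_field_derivative F 0 z * poly Q z * ?e z) (at z)"
    using prim[OF hol(1)] by blast
  obtain B where B: "B 0 = - ray_moment D Q" "\<And>z. (B has_field_derivative F D z * poly Q z * ?e z) (at z)"
    using prim[OF hol(2)] by blast
  define f where "f = (\<lambda>z. (B z * F 0 z - A z * F D z) / W)"
  have f': "(f has_field_derivative (B z * deriv (F 0) z - A z * deriv (F D) z) / W) (at z)" for z
    unfolding f_def
  proof (rule DERIV_cdivide)
    show "((\<lambda>z. B z * F 0 z - A z * F D z) has_field_derivative B z * deriv (F 0) z - A z * deriv (F D) z) (at z)"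
      by (auto intro!: derivative_eq_intros A B solves_sobolev_odeD(1)[OF F0] solves_sobolev_odeD(1)[OF FD] simp: algebra_simps)
  qed
  have df: "deriv f = (\<lambda>z. (B z * deriv (F 0) z - A z * deriv (F D) z) / W)"
    using f' by (intro ext DERIV_imp_deriv)
  have ddf: "deriv (deriv f) z = poly (cpoly (pderiv V)) z * deriv f z + f z / of_real lam - poly Q z" for z
  proof (rule DERIV_imp_deriv)
    let ?V = "poly (cpoly (pderiv V)) z"
    have "(deriv f has_field_derivative
        ((B z * (?V * deriv (F 0) z + F 0 z / of_real lam) - A z * (?V * deriv (F D) z + F D z / of_real lam))
          - poly Q z * concomitant V (F 0) (F D) z) / W) (at z)"
      unfolding df
    proof (rule DERIV_cdivide)
      show "((\<lambda>z. B z * deriv (F 0) z - A z * deriv (F D) z) has_field_derivative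
        (B z * (?V * deriv (F 0) z + F 0 z / of_real lam) - A z * (?V * deriv (F D) z + F D z / of_real lam))
          - poly Q z * concomitant V (F 0) (F D) z) (at z)"
        using solves_sobolev_odeD(2)[OF F0, of z] solves_sobolev_odeD(2)[OF FD, of z]
        by (auto intro!: derivative_eq_intros A B simp: concomitant_def algebra_simps)
    qed
    also have "((B z * (?V * deriv (F 0) z + F 0 z / of_real lam) - A z * (?V * deriv (F D) z + F D z / of_real lam))
          - poly Q z * concomitant V (F 0) (F D) z) / W = ?V * deriv f z + f z / of_real lam - poly Q z"
      unfolding W unfolding df unfolding f_def using W0 lam_pos by (simp add: field_simps)
    finally show "(deriv f has_field_derivative ?V * deriv f z + f z / of_real lam - poly Q z) (at z)" .
  qed
  have "f holomorphic_on UNIV" using f' by (auto simp: holomorphic_on_def field_differentiable_def)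
  with ddf have sol: "solves_sobolev_ode V lam Q f" by (simp add: solves_sobolev_ode_def)
  show ?thesis
  proof (intro exI[of _ f] conjI sol allI)
    fix k
    have "W * concomitant V f (F k) 0 = ?e 0 * (B 0 * jet_wr 0 k - A 0 * jet_wr D k)"
      unfolding concomitant_def unfolding df unfolding f_def using W0 by (simp add: jet_wr_def field_simps)
    hence "?e 0 * (jet_wr 0 D * concomitant V f (F k) 0) = ?e 0 * (B 0 * jet_wr 0 k - A 0 * jet_wr D k)"
      by (simp add: W_wr mult.assoc)
    hence "jet_wr 0 D * concomitant V f (F k) 0 = B 0 * jet_wr 0 k - A 0 * jet_wr D k" by simp
    moreover have "jet_wr k 0 = - jet_wr 0 k" by (simp add: jet_wr_def)
    ultimately show "jet_wr 0 D * (concomitant V f (F k) 0 + ray_moment k Q) =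
          jet_wr 0 D * ray_moment k Q + jet_wr D k * ray_moment 0 Q + jet_wr k 0 * ray_moment D Q"
      by (simp add: A B algebra_simps)
  qed
qed

text \<open>
  The rays with arguments \<open>2\<pi>m / (3D)\<close> are the even Sibuya rays if \<open>3\<close> divides \<open>m\<close>, and otherwise
  \<open>V\<close> falls along them, because \<open>cos (2\<pi>m / 3) = - 1 / 2\<close>. So \<open>f\<close> is polynomially bounded on all
  of them. Neighbours enclose an angle of \<open>2\<pi> / (3D)\<close>, which is small enough for functions of order
  \<open>D\<close>; the even rays alone, at a distance of \<open>2\<pi> / D\<close>, would be too far apart.
\<close>

lemma solution_is_poly:
  assumes f: "solves_sobolev_ode V lam Q f"
    and conc: "\<And>j. j < D \<Longrightarrow> concomitant V f (F (2 * j)) 0 + ray_moment (2 * j) Q = 0"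
  shows "\<exists>p. f = poly p"
proof -
  define \<theta> where "\<theta> = (\<lambda>m::nat. 2 * pi * real m / (3 * real D))"
  have hol: "f holomorphic_on UNIV" using f by (simp add: solves_sobolev_ode_def)
  have ray: "\<exists>C\<ge>0. \<exists>N. \<forall>r\<ge>1. norm (f (of_real r * cis (\<theta> m))) \<le> C * r ^ N" for m
  proof (cases "3 dvd m")
    case True
    then obtain i where m: "m = 3 * i" by blast
    define j where "j = i mod D"
    have j: "j < D" by (simp add: j_def)
    have "\<theta> m = pi * real (2 * j) / real D + 2 * pi * real (i div D)"
    proof -
      have "real i = real (i div D) * real D + real j" by (simp add: j_def flip: of_nat_mult of_nat_add)
      thus ?thesis by (simp add: \<theta>_def m field_simps)
    qed
    hence u: "cis (\<theta> m) = ray_dir (2 * j)"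
      by (simp add: cis_multiple_2pi flip: cis_mult)
    show ?thesis unfolding u
    proof (rule ray_bound_of_vanishing_concomitant[OF _ _ f F_solves F_limit])
      show "((\<lambda>r. concomitant V f (F (2 * j)) (of_real r * ray_dir (2 * j))) \<longlongrightarrow> 0) at_top"
        using concomitant_ray_limit[OF f, of "2 * j"] conc[OF j] j by simp
    qed (use j ray_dir_power[of "2 * j"] in auto)
  next
    case False
    have "cis (\<theta> m) ^ D = cis (real D * \<theta> m)" by (rule Complex.DeMoivre)
    also have "real D * \<theta> m = 2 * pi * real m / 3" by (simp add: \<theta>_def)
    finally have "Re (cis (\<theta> m) ^ D) < 0" using cos_third_of_turn_neg[OF False] by simp
    thus ?thesis by (intro ray_bound_of_falling_weight[OF _ _ f]) auto
  qed
  obtain K where K: "\<And>z. norm (f z) \<le> K * exp (K * norm z powr real D)" using solution_growth[OF f] by blast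
  have sector: "\<exists>C\<ge>0. \<exists>N. \<forall>t r. \<theta> m \<le> t \<longrightarrow> t \<le> \<theta> (Suc m) \<longrightarrow> r \<ge> 1 \<longrightarrow> norm (f (rcis r t)) \<le> C * r ^ N" for m
  proof -
    obtain C1 N1 where 1: "C1 \<ge> 0" "\<And>r. r \<ge> 1 \<Longrightarrow> norm (f (of_real r * cis (\<theta> m))) \<le> C1 * r ^ N1" using ray[of m] by blast
    obtain C2 N2 where 2: "C2 \<ge> 0" "\<And>r. r \<ge> 1 \<Longrightarrow> norm (f (of_real r * cis (\<theta> (Suc m)))) \<le> C2 * r ^ N2" using ray[of "Suc m"] by blast
    have \<theta>_diff: "\<theta> (Suc m) - \<theta> m = 2 * pi / (3 * real D)" by (simp add: \<theta>_def add_divide_distrib algebra_simps)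
    have "\<exists>M'. \<forall>t r. \<theta> m \<le> t \<longrightarrow> t \<le> \<theta> (Suc m) \<longrightarrow> r \<ge> 1 \<longrightarrow> norm (f (rcis r t)) \<le> M' * r ^ (N1 + N2)"
    proof (rule phragmen_lindelof_sector[OF hol _ _ _ _ K, where b = "real D + 1" and M = "C1 + C2"])
      have "0 < 2 * pi / (3 * real D)" by simp
      thus "\<theta> m \<le> \<theta> (Suc m)" using \<theta>_diff by linarith
      \<comment> \<open>the damping exponent \<open>D + 1\<close> exceeds the order of growth, and \<open>2 (D + 1) < 3 D\<close>\<close>
      show "(real D + 1) * (\<theta> (Suc m) - \<theta> m) < pi"
        unfolding \<theta>_diff using D4 by (simp add: field_simps)
      fix r :: real assume r: "r \<ge> 1"
      have "norm (f (rcis r (\<theta> m))) \<le> C1 * r ^ N1" using 1(2)[OF r] by (simp add: rcis_def)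
      also have "\<dots> \<le> (C1 + C2) * r ^ (N1 + N2)" using 1 2 r by (intro mult_mono power_increasing) auto
      finally show "norm (f (rcis r (\<theta> m))) \<le> (C1 + C2) * r ^ (N1 + N2)" .
      have "norm (f (rcis r (\<theta> (Suc m)))) \<le> C2 * r ^ N2" using 2(2)[OF r] by (simp add: rcis_def)
      also have "\<dots> \<le> (C1 + C2) * r ^ (N1 + N2)" using 1 2 r by (intro mult_mono power_increasing) auto
      finally show "norm (f (rcis r (\<theta> (Suc m)))) \<le> (C1 + C2) * r ^ (N1 + N2)" .
    qed auto
    then obtain M' where M': "\<And>t r. \<theta> m \<le> t \<Longrightarrow> t \<le> \<theta> (Suc m) \<Longrightarrow> r \<ge> 1 \<Longrightarrow> norm (f (rcis r t)) \<le> M' * r ^ (N1 + N2)" by blast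
    have "norm (f (rcis r t)) \<le> \<bar>M'\<bar> * r ^ (N1 + N2)" if "\<theta> m \<le> t" "t \<le> \<theta> (Suc m)" "r \<ge> 1" for t r
      using M'[OF that] that by (intro order_trans[OF M'[OF that] mult_right_mono]) auto
    thus ?thesis by (intro exI[of _ "\<bar>M'\<bar>"]) auto
  qed
  then obtain C N where CN: "\<And>m. C m \<ge> 0"
    "\<And>m t r. \<theta> m \<le> t \<Longrightarrow> t \<le> \<theta> (Suc m) \<Longrightarrow> r \<ge> 1 \<Longrightarrow> norm (f (rcis r t)) \<le> C m * r ^ N m"
    by metis
  define C' where "C' = (\<Sum>m<3*D. C m)"
  define N' where "N' = (\<Sum>m<3*D. N m)"
  have "norm (f z) \<le> C' * norm z ^ N'" if z: "norm z \<ge> 1" for z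
  proof -
    define t where "t = Arg2pi z"
    have t: "0 \<le> t" "t < 2 * pi" by (auto simp: t_def Arg2pi)
    define m where "m = nat \<lfloor>t * (3 * real D) / (2 * pi)\<rfloor>"
    have x0: "0 \<le> t * (3 * real D) / (2 * pi)" using t by simp
    hence "real m = of_int \<lfloor>t * (3 * real D) / (2 * pi)\<rfloor>" by (simp add: m_def)
    hence m: "real m \<le> t * (3 * real D) / (2 * pi)" "t * (3 * real D) / (2 * pi) < real m + 1" by linarith+
    have "\<theta> m \<le> t" "t \<le> \<theta> (Suc m)" using m by (simp_all add: \<theta>_def field_simps)
    moreover have "m < 3 * D"
    proof -
      have "t * (3 * real D) / (2 * pi) < 3 * real D" using t by (simp add: divide_less_eq)
      hence "real m < real (3 * D)" using m by simp
      thus ?thesis by simp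
    qed
    moreover have "z = rcis (norm z) t" unfolding t_def rcis_def cis_conv_exp by (rule Arg2pi_eq)
    ultimately have "norm (f z) \<le> C m * norm z ^ N m" using CN(2)[of m t "norm z"] z by metis
    also have "\<dots> \<le> C' * norm z ^ N'"
    proof (intro mult_mono power_increasing)
      show "C m \<le> C'" unfolding C'_def using \<open>m < 3 * D\<close> CN(1) by (intro member_le_sum) auto
      show "N m \<le> N'" unfolding N'_def using \<open>m < 3 * D\<close> by (intro member_le_sum) auto
      show "0 \<le> C'" unfolding C'_def using CN(1) by (intro sum_nonneg) auto
    qed (use z in auto)
    finally show ?thesis .
  qed
  from entire_power_bounded_imp_poly[OF hol this] show ?thesis .
qed

section \<open>The ray conditions\<close>

lemma Y_moment_eq:
  assumes "even k"
  shows "Y_moment D V lam F k Q = \<i> ^ k * exp (- \<i> * of_real pi / 4) * ray_moment k Q"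
proof -
  have "sibuya_Y V lam F k z * exp (- poly (cpoly V) z / 2) * poly Q z =
    \<i> ^ k * exp (- \<i> * of_real pi / 4) * (F k z * poly Q z * exp (- poly (cpoly V) z))" for z
  proof -
    have "exp (- poly (cpoly V) z) = exp (- poly (cpoly V) z / 2) * exp (- poly (cpoly V) z / 2)"
      by (simp flip: exp_add)
    thus ?thesis using assms by (simp add: sibuya_Y_def)
  qed
  hence "Y_moment D V lam F k Q = (LBINT r:{0..}. (\<i> ^ k * exp (- \<i> * of_real pi / 4)) *
     (F k (of_real r * ray_dir k) * poly Q (of_real r * ray_dir k) * exp (- poly (cpoly V) (of_real r * ray_dir k)) * ray_dir k))"
    by (simp only: Y_moment_def ray_integral_def mult.assoc)
  also have "\<dots> = \<i> ^ k * exp (- \<i> * of_real pi / 4) * ray_moment k Q"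
    unfolding ray_moment_def ray_integral_def by (rule set_integral_mult_right)
  finally show ?thesis .
qed

text \<open>
  The factor \<open>exp (- V / 2)\<close> contributes the same multiple of the function to each derivative, which
  drops out of the Wronskian.
\<close>

lemma wronskian_sibuya_Y:
  assumes a: "a < 2 * D" "even a" and b: "b < 2 * D" "even b"
  shows "wronskian (sibuya_Y V lam F a) (sibuya_Y V lam F b) 0 =
    (\<i> ^ a * exp (- \<i> * of_real pi / 4)) * (\<i> ^ b * exp (- \<i> * of_real pi / 4)) * exp (- poly (cpoly V) 0) * jet_wr a b"
proof -
  let ?c = "exp (- \<i> * of_real pi / 4)" and ?e = "exp (- poly (cpoly V) 0 / 2)"
  have d: "deriv (sibuya_Y V lam F k) 0 = \<i> ^ k * ?c * ?e * (deriv (F k) 0 - poly (cpoly (pderiv V)) 0 / 2 * F k 0)"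
    if k: "k < 2 * D" "even k" for k
  proof (rule DERIV_imp_deriv)
    have "sibuya_Y V lam F k = (\<lambda>z. \<i> ^ k * ?c * exp (- poly (cpoly V) z / 2) * F k z)"
      using k by (auto simp: sibuya_Y_def)
    thus "(sibuya_Y V lam F k has_field_derivative \<i> ^ k * ?c * ?e * (deriv (F k) 0 - poly (cpoly (pderiv V)) 0 / 2 * F k 0)) (at 0)"
      by (auto intro!: derivative_eq_intros solves_sobolev_odeD(1)[OF F_solves[OF k]] simp: cpoly_pderiv algebra_simps)
  qed
  have "exp (- poly (cpoly V) 0) = ?e * ?e" by (simp flip: exp_add)
  thus ?thesis unfolding wronskian_def d[OF a] d[OF b] using a b by (simp add: sibuya_Y_def jet_wr_def algebra_simps)
qed

text \<open>
  Clearing the denominator and the normalising factors \<open>i ^ k exp (- i \<pi> / 4)\<close> of the \<open>Y\<^sub>k\<close>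
  turns the ray condition into a form that is symmetric under cyclic permutations of the indices
  \<open>0\<close>, \<open>D\<close> and \<open>2j\<close>.
\<close>

lemma ray_condition_iff:
  assumes j: "j < D"
  shows "Y_moment D V lam F (2 * j) Q - conn_beta D V lam F j * Y_moment D V lam F 0 Q
        - conn_kappa D V lam F j * Y_moment D V lam F D Q = 0 \<longleftrightarrow>
     jet_wr 0 D * ray_moment (2 * j) Q + jet_wr D (2 * j) * ray_moment 0 Q + jet_wr (2 * j) 0 * ray_moment D Q = 0"
    (is "?L = 0 \<longleftrightarrow> ?R = 0")
proof -
  define c where "c = exp (- \<i> * of_real pi / 4)"
  define e where "e = exp (- poly (cpoly V) 0)"
  define x where "x = (\<i> :: complex) ^ D"
  define y where "y = (\<i> :: complex) ^ (2 * j)"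
  have ne: "c \<noteq> 0" "e \<noteq> 0" "x \<noteq> 0" "y \<noteq> 0" "jet_wr 0 D \<noteq> 0" by (auto simp: c_def e_def x_def y_def jet_wr_0_D_nonzero)
  have beta: "conn_beta D V lam F j = - (y * jet_wr D (2 * j) / jet_wr 0 D)"
    unfolding conn_beta_def using j evenD wronskian_sibuya_Y[of D "2 * j"] wronskian_sibuya_Y[of 0 D] ne
    by (simp flip: c_def e_def x_def y_def)
  have kappa: "conn_kappa D V lam F j = y * jet_wr 0 (2 * j) / (x * jet_wr 0 D)"
    unfolding conn_kappa_def using j evenD wronskian_sibuya_Y[of 0 "2 * j"] wronskian_sibuya_Y[of 0 D] ne
    by (simp flip: c_def e_def x_def y_def)
  have Y: "Y_moment D V lam F (2 * j) Q = y * c * ray_moment (2 * j) Q" "Y_moment D V lam F 0 Q = c * ray_moment 0 Q"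
    "Y_moment D V lam F D Q = x * c * ray_moment D Q"
    using Y_moment_eq[of "2 * j" Q] Y_moment_eq[of 0 Q] Y_moment_eq[OF evenD, of Q]
    by (simp_all only: c_def x_def y_def dvd_triv_left dvd_0_right power_0 mult_1_left)
  have "?L = y * c / jet_wr 0 D * (jet_wr 0 D * ray_moment (2 * j) Q + jet_wr D (2 * j) * ray_moment 0 Q - jet_wr 0 (2 * j) * ray_moment D Q)"
    unfolding beta kappa Y using ne by (simp add: field_simps)
  also have "jet_wr 0 D * ray_moment (2 * j) Q + jet_wr D (2 * j) * ray_moment 0 Q - jet_wr 0 (2 * j) * ray_moment D Q = ?R"
    by (simp add: jet_wr_def algebra_simps)
  finally show ?thesis using ne by simp
qed

text \<open>
  For \<open>Q = L P\<close> the ray moments are Wronskians with the pair \<open>(P 0, P' 0)\<close>, and the condition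
  becomes the Pluecker relation between four vectors of the plane. In the other direction the
  conditions for \<open>j = 0\<close> and \<open>2 j = D\<close>, which the index set omits, hold trivially, so the
  concomitant of a suitable entire solution vanishes at the end of every even ray.
\<close>

lemma ray_conditions_iff_sobolev_op:
  "(\<forall>j \<in> {1..D - 1} - {D div 2}.
        Y_moment D V lam F (2 * j) Q - conn_beta D V lam F j * Y_moment D V lam F 0 Q
        - conn_kappa D V lam F j * Y_moment D V lam F D Q = 0) \<longleftrightarrow>
   (\<exists>P. Q = sobolev_op (cpoly V) (of_real (1 / lam)) P)" (is "?L \<longleftrightarrow> ?R")
proof
  assume ?L
  have cond: "jet_wr 0 D * ray_moment (2 * j) Q + jet_wr D (2 * j) * ray_moment 0 Q + jet_wr (2 * j) 0 * ray_moment D Q = 0"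
    if j: "j < D" for j
  proof -
    consider "j = 0" | "2 * j = D" | "j \<in> {1..D - 1} - {D div 2}" using j evenD by fastforce
    thus ?thesis
    proof cases
      case 3
      with \<open>?L\<close> ray_condition_iff[OF j] show ?thesis by blast
    qed (auto simp: jet_wr_def algebra_simps)
  qed
  obtain f where f: "solves_sobolev_ode V lam Q f"
    and c: "\<And>k. jet_wr 0 D * (concomitant V f (F k) 0 + ray_moment k Q) =
          jet_wr 0 D * ray_moment k Q + jet_wr D k * ray_moment 0 Q + jet_wr k 0 * ray_moment D Q"
    using entire_solution_exists[of Q] by blast
  have "concomitant V f (F (2 * j)) 0 + ray_moment (2 * j) Q = 0" if "j < D" for j
    using c[of "2 * j"] cond[OF that] jet_wr_0_D_nonzero by simp
  then obtain P where "f = poly P" using solution_is_poly[OF f] by blast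
  with f have "solves_sobolev_ode V lam Q (poly P)" by simp
  hence "sobolev_op (cpoly V) (of_real (1 / lam)) P = Q" by (rule iffD1[OF solves_sobolev_ode_poly])
  thus ?R by (intro exI[of _ P]) simp
next
  assume ?R
  then obtain P where Q: "Q = sobolev_op (cpoly V) (of_real (1 / lam)) P" by blast
  have m: "ray_moment k Q = exp (- poly (cpoly V) 0) * (deriv (poly P) 0 * F k 0 - poly P 0 * deriv (F k) 0)" if "k < 2 * D" "even k" for k
    unfolding Q ray_moment_sobolev_op[OF that] concomitant_def by (simp add: algebra_simps)
  show ?L
  proof
    fix j assume "j \<in> {1..D - 1} - {D div 2}"
    hence j: "j < D" using D4 by auto
    show "Y_moment D V lam F (2 * j) Q - conn_beta D V lam F j * Y_moment D V lam F 0 Q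
        - conn_kappa D V lam F j * Y_moment D V lam F D Q = 0"
      unfolding ray_condition_iff[OF j] using j evenD by (simp add: m jet_wr_def algebra_simps)
  qed
qed

section \<open>The orthogonality problem\<close>

text \<open>
  By the ray conditions \<open>Q = L f\<close>. The difference \<open>g\<close> of \<open>f\<close> and \<open>\<nu>\<^sub>n P\<^sub>n\<close> has degree less than \<open>n\<close>,
  because in \<open>L g\<close> the leading terms of two monic polynomials of degree \<open>n + D - 2\<close> cancel, and the
  conditions on the real line then force \<open>g = 0\<close>.
\<close>

lemma solves_problem_iff:
  assumes n: "n \<ge> 1"
  shows "solves_problem D V lam F n Q \<longleftrightarrow> Q = cpoly (dual_poly D \<gamma> V lam n)"
proof
  let ?op = "sobolev_op (cpoly V) (of_real (1 / lam))"
  let ?\<nu> = "dual_norm D \<gamma> lam n"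
  define P where "P = smult (of_real ?\<nu>) (cpoly (sobolev_poly V lam n))"
  have dual: "cpoly (dual_poly D \<gamma> V lam n) = ?op P"
    by (simp only: P_def dual_poly_eq cpoly_smult cpoly_sobolev_op sobolev_op_smult)
  note monic = dual_poly_monic[OF n]
  {
    assume "Q = cpoly (dual_poly D \<gamma> V lam n)"
    moreover have "\<exists>P. cpoly (dual_poly D \<gamma> V lam n) = ?op P" using dual by blast
    ultimately show "solves_problem D V lam F n Q"
      unfolding solves_problem_def ray_conditions_iff_sobolev_op
      using monic dual_poly_orthogonal by (auto simp: degree_map_poly coeff_map_poly)
  }
  assume Q: "solves_problem D V lam F n Q"
  hence deg_Q: "degree Q = n + D - 2" and lead_Q: "lead_coeff Q = 1" unfolding solves_problem_def by blast+
  from Q obtain f where f: "Q = ?op f" unfolding solves_problem_def ray_conditions_iff_sobolev_op by blast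
  define g where "g = f - P"
  have opg: "?op g = Q - cpoly (dual_poly D \<gamma> V lam n)" by (simp add: g_def sobolev_op_diff f dual)
  have top: "coeff (?op g) i = 0" if "i \<ge> n + D - 2" for i
  proof (cases "i = n + D - 2")
    case True
    have "coeff Q (n + D - 2) = 1" using deg_Q lead_Q by simp
    moreover have "coeff (cpoly (dual_poly D \<gamma> V lam n)) (n + D - 2) = 1" using monic by (simp add: coeff_map_poly)
    ultimately show ?thesis unfolding opg True by simp
  next
    case False
    hence "degree Q < i" "degree (cpoly (dual_poly D \<gamma> V lam n)) < i"
      using deg_Q monic that by (auto simp: degree_map_poly)
    thus ?thesis unfolding opg by (simp add: coeff_eq_0)
  qed
  have "degree g < n"
  proof (rule ccontr)
    assume "\<not> degree g < n"
    hence dg: "degree g \<ge> n" "degree g \<ge> 1" using n by auto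
    have "degree (?op g) = degree g + D - 2" "lead_coeff (?op g) \<noteq> 0"
      using degree_sobolev_op[of "cpoly V" g "of_real (1 / lam)"] dg D4 \<gamma>pos by auto
    moreover have "n + D - 2 \<le> degree g + D - 2" using dg by simp
    ultimately show False using top[of "degree (?op g)"] by simp
  qed
  have "g = 0"
  proof (rule eq_0_if_sobolev_op_orthogonal[of n])
    show "coeff g i = 0" if "i \<ge> n" for i using that \<open>degree g < n\<close> by (intro coeff_eq_0) simp
    fix k assume k: "k < n"
    have "(LBINT x. of_real x ^ k * poly (?op g) (of_real x) * of_real (exp (- poly V x))) =
      (LBINT x. poly (monom 1 k * Q) (of_real x) * of_real (exp (- poly V x))
         - poly (monom 1 k * cpoly (dual_poly D \<gamma> V lam n)) (of_real x) * of_real (exp (- poly V x)))"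
      unfolding opg by (simp add: poly_monom algebra_simps)
    also have "\<dots> = (LBINT x. poly (monom 1 k * Q) (of_real x) * of_real (exp (- poly V x)))
         - (LBINT x. poly (monom 1 k * cpoly (dual_poly D \<gamma> V lam n)) (of_real x) * of_real (exp (- poly V x)))"
      by (intro Bochner_Integration.integral_diff integrable_complex_weight)
    also have "\<dots> = 0 - 0"
      using Q k dual_poly_orthogonal[OF k] by (simp add: poly_monom solves_problem_def)
    finally show "(LBINT x. of_real x ^ k * poly (?op g) (of_real x) * of_real (exp (- poly V x))) = (0::complex)" by simp
  qed
  thus "Q = cpoly (dual_poly D \<gamma> V lam n)" using opg by (simp add: sobolev_op_def)
qed

end

theorem corollary2p30:
  fixes D n :: nat and \<gamma> lam \<rho> :: real and V :: "real poly"
    and \<phi> \<psi> :: "complex \<Rightarrow> complex" and F :: "nat \<Rightarrow> complex \<Rightarrow> complex"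
  assumes "D \<ge> 4" and "even D" and "lam > 0"
    and "degree V = D" and "lead_coeff V = \<gamma>" and "\<gamma> > 0"
    and "sibuya_chart D \<gamma> V \<rho> \<phi> \<psi>"
    and "\<forall>k<2 * D. is_sibuya_F D V lam \<rho> \<psi> k (F k)"
    and "n \<ge> 1"
  shows "\<forall>Q :: complex poly. solves_problem D V lam F n Q \<longleftrightarrow> Q = cpoly (dual_poly D \<gamma> V lam n)"
proof -
  interpret sibuya_solutions D \<gamma> V lam F
  proof
    fix k assume k: "k < 2 * D" "even k"
    hence F: "is_sibuya_F D V lam \<rho> \<psi> k (F k)" using assms(8) by blast
    thus "solves_sobolev_ode V lam 0 (F k)" using k
      by (auto simp: is_sibuya_F_def solves_sobolev_ode_def algebra_simps eq_neg_iff_add_eq_0 add_eq_0_iff2)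
    show "((\<lambda>r. F k (of_real r * cis (pi * real k / real D))) \<longlongrightarrow> 1) at_top"
      by (rule sibuya_ray_limit[OF assms(7) F]) (use assms(1) in simp)
  qed (use assms in auto)
  show ?thesis using solves_problem_iff[OF assms(9)] by blast
qed

end
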